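(* For every $t>0$, $0\le r<\frac{\pi}{2}$ and $z\in[-\pi,\pi]$, $$p_t(r,z)=\sum_{n=-\infty}^{+\infty}\sum_{k=0}^{+\infty}(2k+|n|+1)\,e^{-(4k(k+|n|+1)+2|n|)t}\,e^{inz}(\cos r)^{|n|}P_k^{0,|n|}(\cos 2r),$$ where $$P_k^{0,|n|}(x)=\frac{(-1)^k}{2^k k!\,(1+x)^{|n|}}\frac{d^k}{dx^k}\left((1+x)^{|n|}(1-x^2)^k\right)$$ is a Jacobi polynomial.
   Context: $\mathbf{SU}(2)$ is the group of $2\times2$ complex unitary matrices of determinant $1$. Let $X,Y,Z$ be the left-invariant vector fields on $\mathbf{SU}(2)$ corresponding to the elements $\begin{pmatrix}0&1\\-1&0\end{pmatrix}$, $\begin{pmatrix}0&i\\i&0\end{pmatrix}$, $\begin{pmatrix}i&0\\0&-i\end{pmatrix}$ of its Lie algebra; they satisfy $[Z,X]=2Y$, $[X,Y]=2Z$, $[Y,Z]=2X$. Put $\mathcal L=X^2+Y^2$ (a subelliptic operator). Cylindric coordinates $(r,\theta,z)$, $0\le r<\pi/2$, $\theta\in[0,2\pi]$, $z\in[-\pi,\pi]$, are given by $$(r,\theta,z)\mapsto \exp(r\cos\theta\,X+r\sin\theta\,Y)\exp(zZ)=\begin{pmatrix}\cos r\,e^{iz}&\sin r\,e^{i(\theta-z)}\\-\sin r\,e^{-i(\theta-z)}&\cos r\,e^{-iz}\end{pmatrix}.$$ The normalized bi-invariant Haar measure is $d\mu=\frac{1}{4\pi^2}\sin 2r\,dr\,d\theta\,dz$.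 The semigroup $P_t=e^{t\mathcal L}$ has a smooth kernel with respect to $\mu$; the heat kernel issued from the identity, i.e. the function $p_t$ with $(P_tf)(\text{identity})=\int p_t f\,d\mu$, depends only on $(r,z)$ and is written $p_t(r,z)$. *)

theory Defs
  imports "HOL-Analysis.Analysis"
begin

section \<open>The group SU(2)\<close>

definition adjoint_mat :: "complex^'n^'m \<Rightarrow> complex^'m^'n" where
  "adjoint_mat A = (\<chi> i j. cnj (A $ j $ i))"

definition SU2 :: "(complex^2^2) set" where
  "SU2 = {A. A ** adjoint_mat A = mat 1 \<and> adjoint_mat A ** A = mat 1 \<and> det A = 1}"

lemma mat_1_in_SU2: "mat 1 \<in> SU2"
proof -
  have "adjoint_mat (mat 1 :: complex^2^2) = mat 1"
    by (simp add: adjoint_mat_def mat_def vec_eq_iff)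
  then show ?thesis
    by (simp add: SU2_def)
qed

typedef su2 = SU2
  using mat_1_in_SU2 by blast

text \<open>The topology is the one induced from the space of matrices.\<close>

instantiation su2 :: metric_space
begin

definition dist_su2 :: "su2 \<Rightarrow> su2 \<Rightarrow> real" where
  "dist_su2 g h = dist (Rep_su2 g) (Rep_su2 h)"

definition uniformity_su2 :: "(su2 \<times> su2) filter" where
  "uniformity_su2 = (INF e\<in>{0 <..}. principal {(x, y). dist x y < e})"

definition open_su2 :: "su2 set \<Rightarrow> bool" where
  "open_su2 U \<longleftrightarrow> (\<forall>x\<in>U. eventually (\<lambda>(x', y). x' = x \<longrightarrow> y \<in> U) uniformity)"

instance
proof
  fix x y z :: su2
  show "(uniformity :: (su2 \<times> su2) filter) = (INF e\<in>{0 <..}. principal {(x, y). dist x y < e})"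
    by (rule uniformity_su2_def)
  show "open U \<longleftrightarrow> (\<forall>x\<in>U. eventually (\<lambda>(x', y). x' = x \<longrightarrow> y \<in> U) uniformity)" for U :: "su2 set"
    by (rule open_su2_def)
  show "dist x y = 0 \<longleftrightarrow> x = y"
    by (simp add: dist_su2_def Rep_su2_inject)
  show "dist x y \<le> dist x z + dist y z"
    unfolding dist_su2_def by (rule dist_triangle2)
qed

end

definition su2_one :: su2 where
  "su2_one = Abs_su2 (mat 1)"

section \<open>Left-invariant vector fields and the sub-Laplacian\<close>

definition mat_exp :: "complex^'n^'n \<Rightarrow> complex^'n^'n" where
  "mat_exp A = (\<Sum>k. (1 / fact k) *\<^sub>R (((**) A) ^^ k) (mat 1))"

definition matX :: "complex^2^2" where
  "matX = vector [vector [0, 1], vector [-1, 0]]"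

definition matY :: "complex^2^2" where
  "matY = vector [vector [0, \<i>], vector [\<i>, 0]]"

text \<open>Only meaningful for \<open>V\<close> in the Lie algebra of SU(2), so that the argument of
  \<^const>\<open>Abs_su2\<close> below lies in \<^const>\<open>SU2\<close>.\<close>

definition left_inv_field :: "complex^2^2 \<Rightarrow> (su2 \<Rightarrow> real) \<Rightarrow> su2 \<Rightarrow> real" where
  "left_inv_field V f g = deriv (\<lambda>s. f (Abs_su2 (Rep_su2 g ** mat_exp (s *\<^sub>R V)))) 0"

definition sub_laplacian :: "(su2 \<Rightarrow> real) \<Rightarrow> su2 \<Rightarrow> real" where
  "sub_laplacian f g =
     left_inv_field matX (left_inv_field matX f) g + left_inv_field matY (left_inv_field matY f) g"

section \<open>Smooth functions\<close>

primrec Ck :: "nat \<Rightarrow> ('a::euclidean_space \<Rightarrow> real) \<Rightarrow> bool" where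
  "Ck 0 F \<longleftrightarrow> continuous_on UNIV F"
| "Ck (Suc k) F \<longleftrightarrow>
     (\<exists>F'. (\<forall>x. (F has_derivative F' x) (at x)) \<and> (\<forall>v. Ck k (\<lambda>x. F' x v)))"

text \<open>SU(2) is a closed submanifold of the matrix space, so its smooth functions are the
  restrictions of smooth functions on that space.\<close>

definition su2_smooth :: "(su2 \<Rightarrow> real) \<Rightarrow> bool" where
  "su2_smooth f \<longleftrightarrow> (\<exists>F :: complex^2^2 \<Rightarrow> real. (\<forall>k. Ck k F) \<and> f = F \<circ> Rep_su2)"

section \<open>Cylindric coordinates and Haar measure\<close>

definition cylindric :: "real \<Rightarrow> real \<Rightarrow> real \<Rightarrow> su2" where
  "cylindric r \<theta> z = Abs_su2 (vector
     [vector [complex_of_real (cos r) * cis z, complex_of_real (sin r) * cis (\<theta> - z)],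
      vector [- complex_of_real (sin r) * cis (- (\<theta> - z)), complex_of_real (cos r) * cis (- z)]])"

definition su2_haar :: "su2 measure" where
  "su2_haar = distr
     (density (lborel :: (real \<times> real \<times> real) measure)
       (\<lambda>(r, \<theta>, z). ennreal (indicator ({0..<pi/2} \<times> {0..2*pi} \<times> {-pi..pi}) (r, \<theta>, z)
                              * (1 / (4 * pi\<^sup>2)) * sin (2 * r))))
     borel (\<lambda>(r, \<theta>, z). cylindric r \<theta> z)"

section \<open>The heat semigroup and its kernel\<close>

definition C0_semigroup :: "(real \<Rightarrow> 'a::real_normed_vector \<Rightarrow>\<^sub>L 'a) \<Rightarrow> bool" where
  "C0_semigroup P \<longleftrightarrow>
     P 0 = id_blinfun \<and>
     (\<forall>s\<ge>0. \<forall>t\<ge>0. P (s + t) = P s o\<^sub>L P t) \<and>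
     (\<forall>f. ((\<lambda>t. blinfun_apply (P t) f) \<longlongrightarrow> f) (at_right 0))"

text \<open>Unbounded operators are represented by their graphs.\<close>

definition generator :: "(real \<Rightarrow> 'a::real_normed_vector \<Rightarrow>\<^sub>L 'a) \<Rightarrow> ('a \<times> 'a) set" where
  "generator P =
     {(f, g). ((\<lambda>t. (1 / t) *\<^sub>R (blinfun_apply (P t) f - f)) \<longlongrightarrow> g) (at_right 0)}"

text \<open>Since SU(2) is compact, \<open>su2 \<Rightarrow>\<^sub>C real\<close> is the Banach space of all continuous functions
  on SU(2) with the supremum norm.\<close>

definition sub_laplacian_graph :: "((su2 \<Rightarrow>\<^sub>C real) \<times> (su2 \<Rightarrow>\<^sub>C real)) set" where
  "sub_laplacian_graph =
     {(f, g). su2_smooth (apply_bcontfun f) \<and>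
              apply_bcontfun g = sub_laplacian (apply_bcontfun f)}"

text \<open>\<open>P\<^sub>t = exp(t L)\<close>: the semigroup generated by the closure of \<open>L\<close> on smooth functions.\<close>

definition is_heat_semigroup :: "(real \<Rightarrow> (su2 \<Rightarrow>\<^sub>C real) \<Rightarrow>\<^sub>L (su2 \<Rightarrow>\<^sub>C real)) \<Rightarrow> bool" where
  "is_heat_semigroup P \<longleftrightarrow> C0_semigroup P \<and> generator P = closure sub_laplacian_graph"

definition is_heat_kernel ::
    "(real \<Rightarrow> (su2 \<Rightarrow>\<^sub>C real) \<Rightarrow>\<^sub>L (su2 \<Rightarrow>\<^sub>C real)) \<Rightarrow> (real \<Rightarrow> su2 \<Rightarrow> real) \<Rightarrow> bool" where
  "is_heat_kernel P p \<longleftrightarrow>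
     (\<forall>t>0. su2_smooth (p t) \<and>
        (\<forall>f. apply_bcontfun (blinfun_apply (P t) f) su2_one
             = (LINT g|su2_haar. p t g * apply_bcontfun f g)))"

section \<open>Jacobi polynomials\<close>

text \<open>The Jacobi polynomial \<open>P\<^sub>k\<close> with parameters \<open>(0, m)\<close>, by Rodrigues' formula;
  to be used for \<open>x \<noteq> -1\<close> only, because of the division.\<close>

definition jacobi0 :: "nat \<Rightarrow> nat \<Rightarrow> real \<Rightarrow> real" where
  "jacobi0 m k x =
     (-1) ^ k / (2 ^ k * fact k * (1 + x) ^ m)
       * (deriv ^^ k) (\<lambda>y. (1 + y) ^ m * (1 - y\<^sup>2) ^ k) x"

definition heat_term :: "real \<Rightarrow> real \<Rightarrow> real \<Rightarrow> int \<Rightarrow> nat \<Rightarrow> complex" where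
  "heat_term t r z n k =
     (let m = nat \<bar>n\<bar> in
       complex_of_real ((2 * real k + real m + 1)
         * exp (- (4 * real k * (real k + real m + 1) + 2 * real m) * t))
       * exp (\<i> * of_int n * complex_of_real z)
       * complex_of_real (cos r ^ m * jacobi0 m k (cos (2 * r))))"

end

theory Submission
  imports Defs
begin

text \<open>Write \<open>a\<close> and \<open>b\<close> for the first row of a matrix in SU(2), so \<open>\<bar>a\<bar>\<^sup>2 + \<bar>b\<bar>\<^sup>2 = 1\<close>; in cylindric
coordinates \<open>a = cos r cis z\<close> and \<open>b = sin r cis (\<theta> - z)\<close>. A continuous function is determined by its
integrals against polynomials in \<open>a\<close>, \<open>b\<close> and their conjugates, because these are uniformly dense
(Stone--Weierstrass) and the Haar measure charges every open set. So it suffices to know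
\<open>\<integral> p\<^sub>t f d\<mu> = (P\<^sub>t f)(1)\<close> for enough polynomials \<open>f\<close>, and to check that the series on the
right-hand side has the same integrals.

The left-invariant fields \<open>X\<close> and \<open>Y\<close> act on the coordinates by linear substitutions, whence
\<open>L = X\<^sup>2 + Y\<^sup>2\<close> sends \<open>a^i cnj(a)^j b^k\<close> to \<open>4ij a^(i-1) cnj(a)^(j-1) b^k\<close> minus
\<open>4ij + 4ik + 2(i + j + k)\<close> times the monomial itself (\<open>sub_laplacian_monomial\<close>). This triangular
form gives both kinds of information that are needed. For \<open>k > 0\<close> the monomial vanishes at the
identity and induction on \<open>i\<close> shows that \<open>P\<^sub>t\<close> keeps it zero there; this is how the kernel is
seen to depend only on \<open>r\<close> and \<open>z\<close>. For \<open>k = 0\<close> the combinations \<open>a^m P\<^sub>k(2\<bar>a\<bar>\<^sup>2 - 1)\<close>, with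
\<open>P\<^sub>k\<close> the Jacobi polynomial for \<open>(0, m)\<close>, and their complex conjugates are eigenfunctions of \<open>L\<close>, with eigenvalue \<open>-(4k(k + m + 1) + 2m)\<close>: the coefficient recurrence of the
Jacobi polynomials is exactly what makes the off-diagonal terms cancel (\<open>harmonic_generator\<close>).

For an eigenvector \<open>f\<close> of the generator with eigenvalue \<open>l\<close> one has \<open>P\<^sub>t f = exp (l t) f\<close>. The proof cuts
\<open>[0, t]\<close> into \<open>n\<close> equal steps, each of which contributes an error \<open>o(1/n)\<close>; that these errors can
be added up uses a uniform bound for \<open>P\<close> on \<open>[0, t]\<close>, which comes from Baire's theorem
(\<open>C0_semigroup_eigenvector\<close>).

On the other side, the Haar integral in cylindric coordinates factors. The integrals over \<open>\<theta>\<close>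
and \<open>z\<close> are trigonometric, and the substitution \<open>u = cos\<^sup>2 r\<close> turns the integral over \<open>r\<close> into
\<open>\<integral> u^m P\<^sub>k P\<^sub>j du\<close> over \<open>[0, 1]\<close>, which Rodrigues' formula and integration by parts evaluate to
\<open>1/(2k + m + 1)\<close> for \<open>j = k\<close> and to \<open>0\<close> otherwise. The factor \<open>2k + \<bar>n\<bar> + 1\<close> of the series
compensates this norm. The crude coefficient bound \<open>2^k (m + 2k choose k)\<close> for the Jacobi
polynomials is beaten by the exponential weights, so the series converges absolutely in the Banach
space of continuous functions and may be integrated termwise (\<open>heat_series_pairing\<close>).\<close>

section \<open>Coordinates on SU(2) and the action of the sub-Laplacian on monomials\<close>

lemma vec2_eq_iff: "(A::complex^2^2) = B \<longleftrightarrow>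
    A$1$1 = B$1$1 \<and> A$1$2 = B$1$2 \<and> A$2$1 = B$2$1 \<and> A$2$2 = B$2$2"
  by (auto simp: vec_eq_iff forall_2)

lemma mat2_mult_nth:
  "((A::complex^2^2) ** B) $ i $ j = A$i$1 * B$1$j + A$i$2 * B$2$j"
  by (simp add: matrix_matrix_mult_def sum_2)

lemma mat2_one_nth:
  "(mat 1 :: complex^2^2)$1$1 = 1" "(mat 1 :: complex^2^2)$1$2 = 0"
  "(mat 1 :: complex^2^2)$2$1 = 0" "(mat 1 :: complex^2^2)$2$2 = 1"
  by (simp_all add: mat_def)

text \<open>For a unitary matrix of determinant 1 the adjoint is the adjugate; this expresses the second row
through the first.\<close>

lemma SU2_iff:
  "A \<in> SU2 \<longleftrightarrow> A$2$1 = - cnj (A$1$2) \<and> A$2$2 = cnj (A$1$1) \<and>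
     A$1$1 * cnj (A$1$1) + A$1$2 * cnj (A$1$2) = 1"
proof
  assume "A \<in> SU2"
  then have u: "A ** adjoint_mat A = mat 1" and d: "det A = 1"
    by (auto simp: SU2_def)
  have e1: "A$1$1 * cnj (A$1$1) + A$1$2 * cnj (A$1$2) = 1"
    and e2: "A$2$1 * cnj (A$1$1) + A$2$2 * cnj (A$1$2) = 0"
    using u by (simp_all add: vec2_eq_iff mat2_mult_nth mat2_one_nth adjoint_mat_def)
  have e3: "A$1$1 * A$2$2 - A$1$2 * A$2$1 = 1"
    using d by (simp add: det_2)
  have "A$2$1 = - cnj (A$1$2)" "A$2$2 = cnj (A$1$1)"
    using e1 e2 e3 by algebra+
  with e1 show "A$2$1 = - cnj (A$1$2) \<and> A$2$2 = cnj (A$1$1) \<and>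
     A$1$1 * cnj (A$1$1) + A$1$2 * cnj (A$1$2) = 1" by blast
next
  assume "A$2$1 = - cnj (A$1$2) \<and> A$2$2 = cnj (A$1$1) \<and>
     A$1$1 * cnj (A$1$1) + A$1$2 * cnj (A$1$2) = 1"
  then show "A \<in> SU2"
    by (auto simp: SU2_def vec2_eq_iff mat2_mult_nth mat2_one_nth adjoint_mat_def det_2 algebra_simps)
qed

definition ca :: "su2 \<Rightarrow> complex" where "ca g = Rep_su2 g $ 1 $ 1"
definition cb :: "su2 \<Rightarrow> complex" where "cb g = Rep_su2 g $ 1 $ 2"

lemma ca_cb_norm: "ca g * cnj (ca g) + cb g * cnj (cb g) = 1"
  using Rep_su2[of g] by (simp add: SU2_iff ca_def cb_def)

definition su2_of :: "complex \<Rightarrow> complex \<Rightarrow> su2" where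
  "su2_of a b = Abs_su2 (vector [vector [a, b], vector [- cnj b, cnj a]])"

lemma Rep_su2_of:
  assumes "a * cnj a + b * cnj b = 1"
  shows "Rep_su2 (su2_of a b) = vector [vector [a, b], vector [- cnj b, cnj a]]"
  unfolding su2_of_def by (rule Abs_su2_inverse) (use assms in \<open>simp add: SU2_iff\<close>)

lemma ca_su2_of: "a * cnj a + b * cnj b = 1 \<Longrightarrow> ca (su2_of a b) = a"
  and cb_su2_of: "a * cnj a + b * cnj b = 1 \<Longrightarrow> cb (su2_of a b) = b"
  by (simp_all add: ca_def cb_def Rep_su2_of)

text \<open>The two directions of the sub-Laplacian belong to one circle of matrices, with parameter 1 for
\<open>X\<close> and \<open>\<i>\<close> for \<open>Y\<close>. Treating all \<open>c\<close> with \<open>\<bar>c\<bar> = 1\<close> at once means that each derivative is computed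
only once.\<close>

definition horizontal_mat :: "complex \<Rightarrow> complex^2^2" where
  "horizontal_mat c = vector [vector [0, c], vector [- cnj c, 0]]"

lemma matX_eq: "matX = horizontal_mat 1" and matY_eq: "matY = horizontal_mat \<i>"
  by (simp_all add: matX_def matY_def horizontal_mat_def)

text \<open>The powers of \<open>V\<close> alternate between multiples of 1 and of \<open>V\<close>, so the exponential series
separates into the cosine and the sine series.\<close>

lemma mat_exp_square_minus_one:
  fixes V :: "complex^2^2"
  assumes V: "V ** V = - mat 1"
  shows "mat_exp (s *\<^sub>R V) = cos s *\<^sub>R mat 1 + sin s *\<^sub>R V"
proof -
  have pow: "(((**) (s *\<^sub>R V)) ^^ k) (mat 1) =
      (if even k then ((-1) ^ (k div 2) * s ^ k) *\<^sub>R mat 1 else ((-1) ^ (k div 2) * s ^ k) *\<^sub>R V)" for k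
  proof (induction k)
    case (Suc k)
    have "(s *\<^sub>R V) ** (r *\<^sub>R mat 1) = (s * r) *\<^sub>R V" for r :: real
      by (simp add: vec2_eq_iff mat2_mult_nth mat2_one_nth scaleR_conv_of_real[where 'a=complex])
    moreover have "(s *\<^sub>R V) ** (r *\<^sub>R V) = (s * r) *\<^sub>R (V ** V)" for r
      by (simp add: vec2_eq_iff mat2_mult_nth algebra_simps scaleR_conv_of_real[where 'a=complex])
    ultimately show ?case
      using Suc V by (auto simp: elim!: evenE oddE)
  qed simp
  have "(1 / fact k) *\<^sub>R (((**) (s *\<^sub>R V)) ^^ k) (mat 1) =
      (cos_coeff k *\<^sub>R s ^ k) *\<^sub>R mat 1 + (sin_coeff k *\<^sub>R s ^ k) *\<^sub>R V" for k
    unfolding pow by (auto simp: cos_coeff_def sin_coeff_def elim!: evenE oddE)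
  moreover have "(\<lambda>k. (cos_coeff k *\<^sub>R s ^ k) *\<^sub>R (mat 1 :: complex^2^2) + (sin_coeff k *\<^sub>R s ^ k) *\<^sub>R V)
      sums (cos s *\<^sub>R mat 1 + sin s *\<^sub>R V)"
    by (intro sums_add sums_scaleR_left cos_converges sin_converges)
  ultimately show ?thesis
    unfolding mat_exp_def by (simp add: sums_iff)
qed

definition flow :: "complex \<Rightarrow> su2 \<Rightarrow> real \<Rightarrow> su2" where
  "flow c g s = Abs_su2 (Rep_su2 g ** mat_exp (s *\<^sub>R horizontal_mat c))"

lemma flow_coords:
  assumes c: "c * cnj c = 1"
  shows "ca (flow c g s) = of_real (cos s) * ca g - cnj c * of_real (sin s) * cb g" (is ?A)
    and "cb (flow c g s) = of_real (cos s) * cb g + c * of_real (sin s) * ca g" (is ?B)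
proof -
  have V: "horizontal_mat c ** horizontal_mat c = - mat 1"
    using c by (simp add: vec2_eq_iff mat2_mult_nth mat2_one_nth horizontal_mat_def mult.commute)
  let ?M = "Rep_su2 g ** (cos s *\<^sub>R mat 1 + sin s *\<^sub>R horizontal_mat c)"
  have r: "Rep_su2 g $ 2 $ 1 = - cnj (cb g)" "Rep_su2 g $ 2 $ 2 = cnj (ca g)"
    using Rep_su2[of g] by (auto simp: SU2_iff ca_def cb_def)
  have M: "?M $1$1 = of_real (cos s) * ca g - cnj c * of_real (sin s) * cb g" "?M $1$2 = of_real (cos s) * cb g + c * of_real (sin s) * ca g"
     "?M $2$1 = - cnj (?M $1$2)" "?M $2$2 = cnj (?M$1$1)"
    by (simp_all add: mat2_mult_nth mat2_one_nth horizontal_mat_def ca_def[symmetric] cb_def[symmetric] r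
        scaleR_conv_of_real[where 'a=complex] algebra_simps)
  have cs: "complex_of_real (cos s) * of_real (cos s) + of_real (sin s) * of_real (sin s) = 1"
    by (metis of_real_1 of_real_add of_real_mult power2_eq_square sin_cos_squared_add2)
  \<comment> \<open>the product lies in SU(2) again, so that the abstraction function may be undone\<close>
  have "?M $1$1 * cnj (?M$1$1) + ?M $1$2 * cnj (?M$1$2) = 1"
    unfolding M(1,2) complex_cnj_diff complex_cnj_add complex_cnj_mult complex_cnj_cnj complex_cnj_complex_of_real
    using c cs ca_cb_norm[of g] by algebra
  with M have "?M \<in> SU2" by (simp add: SU2_iff)
  then have "Rep_su2 (flow c g s) = ?M"
    by (simp add: flow_def mat_exp_square_minus_one[OF V] Abs_su2_inverse)
  with M show ?A ?B by (simp_all add: ca_def[of "flow c g s"] cb_def[of "flow c g s"])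
qed

text \<open>Differentiation of complex functions along the field with parameter \<open>c\<close>. Unlike the operator
\<^const>\<open>left_inv_field\<close>, this relation records existence of the derivative and so is closed under
sums and products.\<close>

definition has_lie_deriv :: "complex \<Rightarrow> (su2 \<Rightarrow> complex) \<Rightarrow> (su2 \<Rightarrow> complex) \<Rightarrow> bool" where
  "has_lie_deriv c F F' \<longleftrightarrow> (\<forall>g. ((\<lambda>s. F (flow c g s)) has_vector_derivative F' g) (at 0))"

lemma flow_0: "c * cnj c = 1 \<Longrightarrow> flow c g 0 = g"
proof -
  assume c: "c * cnj c = 1"
  have V: "horizontal_mat c ** horizontal_mat c = - mat 1"
    using c by (simp add: vec2_eq_iff mat2_mult_nth mat2_one_nth horizontal_mat_def mult.commute)
  show ?thesis using mat_exp_square_minus_one[OF V, of 0]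
    by (simp add: flow_def Rep_su2_inverse)
qed

lemma left_inv_field_Re:
  assumes "has_lie_deriv c F F'"
  shows "left_inv_field (horizontal_mat c) (\<lambda>g. Re (F g)) = (\<lambda>g. Re (F' g))"
proof
  fix g
  have "((\<lambda>s. Re (F (flow c g s))) has_vector_derivative Re (F' g)) (at 0)"
    using assms bounded_linear.has_vector_derivative[OF bounded_linear_Re]
    by (auto simp: has_lie_deriv_def)
  then show "left_inv_field (horizontal_mat c) (\<lambda>g. Re (F g)) g = Re (F' g)"
    unfolding left_inv_field_def flow_def[symmetric]
    by (intro DERIV_imp_deriv) (simp add: has_real_derivative_iff_has_vector_derivative)
qed

lemma has_lie_deriv_const: "has_lie_deriv c (\<lambda>_. k) (\<lambda>_. 0)"
  by (simp add: has_lie_deriv_def)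

lemma has_lie_deriv_add:
  "has_lie_deriv c F F' \<Longrightarrow> has_lie_deriv c G G' \<Longrightarrow>
    has_lie_deriv c (\<lambda>g. F g + G g) (\<lambda>g. F' g + G' g)"
  by (auto simp: has_lie_deriv_def intro!: has_vector_derivative_add)

lemma has_lie_deriv_mult:
  assumes c: "c * cnj c = 1" and "has_lie_deriv c F F'" "has_lie_deriv c G G'"
  shows "has_lie_deriv c (\<lambda>g. F g * G g) (\<lambda>g. F' g * G g + F g * G' g)"
  unfolding has_lie_deriv_def
proof
  fix g
  have "((\<lambda>s. F (flow c g s) * G (flow c g s)) has_vector_derivative
      F (flow c g 0) * G' g + F' g * G (flow c g 0)) (at 0)"
    using assms(2,3) by (intro has_vector_derivative_mult) (auto simp: has_lie_deriv_def)
  then show "((\<lambda>s. F (flow c g s) * G (flow c g s)) has_vector_derivative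
      F' g * G g + F g * G' g) (at 0)"
    by (simp add: flow_0[OF c] add.commute)
qed

lemma has_lie_deriv_power:
  assumes c: "c * cnj c = 1" and F: "has_lie_deriv c F F'"
  shows "has_lie_deriv c (\<lambda>g. F g ^ n) (\<lambda>g. of_nat n * F g ^ (n - 1) * F' g)"
proof (induction n)
  case 0 then show ?case by (simp add: has_lie_deriv_const)
next
  case (Suc n)
  have "of_nat (Suc n) * x ^ (Suc n - 1) * y = y * x ^ n + x * (of_nat n * x ^ (n - 1) * y)"
    for x y :: complex
    by (cases n) (simp_all add: algebra_simps)
  then show ?case
    using has_lie_deriv_mult[OF c F Suc] by simp
qed

lemma has_lie_deriv_coords:
  assumes c: "c * cnj c = 1"
  shows has_lie_deriv_ca: "has_lie_deriv c ca (\<lambda>g. - cnj c * cb g)"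
    and has_lie_deriv_cnj_ca: "has_lie_deriv c (\<lambda>g. cnj (ca g)) (\<lambda>g. - c * cnj (cb g))"
    and has_lie_deriv_cb: "has_lie_deriv c cb (\<lambda>g. c * ca g)"
    and has_lie_deriv_cnj_cb: "has_lie_deriv c (\<lambda>g. cnj (cb g)) (\<lambda>g. cnj c * cnj (ca g))"
proof -
  have cos: "((\<lambda>s. complex_of_real (cos s)) has_vector_derivative 0) (at 0)"
    using has_vector_derivative_of_real[of cos 0 "at 0"] by (auto intro!: derivative_eq_intros)
  have sin: "((\<lambda>s. complex_of_real (sin s)) has_vector_derivative 1) (at 0)"
    using has_vector_derivative_of_real[of sin 1 "at 0"] by (auto intro!: derivative_eq_intros)
  have 1: "((\<lambda>s. of_real (cos s) * x + of_real (sin s) * y) has_vector_derivative y) (at 0)" for x y :: complex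
  proof -
    have "((\<lambda>s. of_real (cos s) * x + of_real (sin s) * y) has_vector_derivative (0 * x + 1 * y)) (at 0)"
      by (intro has_vector_derivative_add has_vector_derivative_mult_left cos sin)
    then show ?thesis by simp
  qed
  have "((\<lambda>s. ca (flow c g s)) has_vector_derivative - cnj c * cb g) (at 0)" for g
    using 1[of "ca g" "- cnj c * cb g"] by (simp add: flow_coords[OF c] algebra_simps)
  then show a: "has_lie_deriv c ca (\<lambda>g. - cnj c * cb g)" by (simp add: has_lie_deriv_def)
  have "((\<lambda>s. cb (flow c g s)) has_vector_derivative c * ca g) (at 0)" for g
    using 1[of "cb g" "c * ca g"] by (simp add: flow_coords[OF c] algebra_simps)
  then show b: "has_lie_deriv c cb (\<lambda>g. c * ca g)" by (simp add: has_lie_deriv_def)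
  show "has_lie_deriv c (\<lambda>g. cnj (ca g)) (\<lambda>g. - c * cnj (cb g))"
    unfolding has_lie_deriv_def
  proof
    fix g
    show "((\<lambda>s. cnj (ca (flow c g s))) has_vector_derivative - c * cnj (cb g)) (at 0)"
      using bounded_linear.has_vector_derivative[OF bounded_linear_cnj a[unfolded has_lie_deriv_def, rule_format, of g]]
      by simp
  qed
  show "has_lie_deriv c (\<lambda>g. cnj (cb g)) (\<lambda>g. cnj c * cnj (ca g))"
    unfolding has_lie_deriv_def
  proof
    fix g
    show "((\<lambda>s. cnj (cb (flow c g s))) has_vector_derivative cnj c * cnj (ca g)) (at 0)"
      using bounded_linear.has_vector_derivative[OF bounded_linear_cnj b[unfolded has_lie_deriv_def, rule_format, of g]]
      by simp
  qed
qed

text \<open>The coefficient \<open>w\<close> is complex because the real parts of these functions must include the imaginary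
parts of the monomials as well.\<close>

definition monomial4 :: "complex \<Rightarrow> nat \<Rightarrow> nat \<Rightarrow> nat \<Rightarrow> nat \<Rightarrow> su2 \<Rightarrow> complex" where
  "monomial4 w i j k l g = w * (ca g ^ i * cnj (ca g) ^ j * cb g ^ k * cnj (cb g) ^ l)"

lemma has_lie_deriv_monomial4:
  assumes c: "c * cnj c = 1"
  shows "has_lie_deriv c (monomial4 w i j k l) (\<lambda>g.
      monomial4 (- cnj c * of_nat i * w) (i - 1) j (k + 1) l g
    + monomial4 (- c * of_nat j * w) i (j - 1) k (l + 1) g
    + monomial4 (c * of_nat k * w) (i + 1) j (k - 1) l g
    + monomial4 (cnj c * of_nat l * w) i (j + 1) k (l - 1) g)"
proof -
  note pw = has_lie_deriv_power[OF c]
  have "has_lie_deriv c (monomial4 w i j k l) (\<lambda>g.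
     0 * (ca g ^ i * cnj (ca g) ^ j * cb g ^ k * cnj (cb g) ^ l) +
     w * (((of_nat i * ca g ^ (i - 1) * (- cnj c * cb g) * cnj (ca g) ^ j
          + ca g ^ i * (of_nat j * cnj (ca g) ^ (j - 1) * (- c * cnj (cb g)))) * cb g ^ k
          + ca g ^ i * cnj (ca g) ^ j * (of_nat k * cb g ^ (k - 1) * (c * ca g))) * cnj (cb g) ^ l
          + ca g ^ i * cnj (ca g) ^ j * cb g ^ k *
              (of_nat l * cnj (cb g) ^ (l - 1) * (cnj c * cnj (ca g)))))" (is "has_lie_deriv _ _ ?D")
    unfolding monomial4_def
    by (intro has_lie_deriv_mult[OF c] has_lie_deriv_const pw has_lie_deriv_coords[OF c])
  moreover have "?D = (\<lambda>g.
      monomial4 (- cnj c * of_nat i * w) (i - 1) j (k + 1) l g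
    + monomial4 (- c * of_nat j * w) i (j - 1) k (l + 1) g
    + monomial4 (c * of_nat k * w) (i + 1) j (k - 1) l g
    + monomial4 (cnj c * of_nat l * w) i (j + 1) k (l - 1) g)"
    by (rule ext) (simp add: monomial4_def algebra_simps)
  ultimately show ?thesis by simp
qed

text \<open>Since \<open>b cnj(b) = 1 - a cnj(a)\<close>, at most one of \<open>b\<close> and its conjugate is needed; complex
conjugation exchanges them, so the powers of \<open>b\<close> suffice for real parts.\<close>

definition monomial :: "complex \<Rightarrow> nat \<Rightarrow> nat \<Rightarrow> nat \<Rightarrow> su2 \<Rightarrow> complex" where
  "monomial w i j k g = w * (ca g ^ i * cnj (ca g) ^ j * cb g ^ k)"

text \<open>In the second derivative in direction \<open>c\<close> the terms proportional to \<open>c\<^sup>2\<close> or its conjugate cancel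
between \<open>c = 1\<close> and \<open>c = \<i>\<close>, and only those proportional to \<open>\<bar>c\<bar>\<^sup>2\<close> remain. The relation
\<open>b cnj(b) = 1 - a cnj(a)\<close> then brings the result back to monomials of the same shape.\<close>

lemma sub_laplacian_monomial:
  "sub_laplacian (\<lambda>g. Re (monomial w i j k g)) =
    (\<lambda>g. 4 * real i * real j * Re (monomial w (i - 1) (j - 1) k g)
       - (4 * real i * real j + 4 * real i * real k + 2 * (real i + real j + real k)) * Re (monomial w i j k g))"
proof
  fix g
  define S where "S c i j k l = (\<lambda>w g.
      monomial4 (- cnj c * of_nat i * w) (i - 1) j (k + 1) l g
    + monomial4 (- c * of_nat j * w) i (j - 1) k (l + 1) g
    + monomial4 (c * of_nat k * w) (i + 1) j (k - 1) l g
    + monomial4 (cnj c * of_nat l * w) i (j + 1) k (l - 1) g)" for c i j k l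
  have S: "has_lie_deriv c (monomial4 w i j k l) (S c i j k l w)" if "c * cnj c = 1" for c w i j k l
    unfolding S_def by (rule has_lie_deriv_monomial4[OF that])
  define T where "T c = (\<lambda>g.
      S c (i - 1) j (k + 1) 0 (- cnj c * of_nat i * w) g
    + S c i (j - 1) k 1 (- c * of_nat j * w) g
    + S c (i + 1) j (k - 1) 0 (c * of_nat k * w) g
    + S c i (j + 1) k 0 0 g)" for c
  have T: "has_lie_deriv c (S c i j k 0 w) (T c)" if "c * cnj c = 1" for c
    unfolding T_def using S[OF that] unfolding S_def[of c i j k]
    by (intro has_lie_deriv_add) simp_all
  have m: "monomial w i j k = monomial4 w i j k 0"
    by (simp add: fun_eq_iff monomial_def monomial4_def)
  have "left_inv_field (horizontal_mat c) (left_inv_field (horizontal_mat c) (\<lambda>g. Re (monomial w i j k g))) g = Re (T c g)"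
    if "c * cnj c = 1" for c
    using left_inv_field_Re[OF S[OF that]] left_inv_field_Re[OF T[OF that]] by (simp add: m)
  then have L: "sub_laplacian (\<lambda>g. Re (monomial w i j k g)) g = Re (T 1 g + T \<i> g)"
    by (simp add: sub_laplacian_def matX_eq matY_eq)
  have b: "cb g * cnj (cb g) = 1 - ca g * cnj (ca g)"
    using ca_cb_norm[of g] by algebra
  \<comment> \<open>With the monomials as opaque atoms only their coefficients have to be compared. The truncated
    exponent \<open>i - 1\<close> always comes with a factor \<open>i\<close>, so \<open>(i - 1) + 1\<close> may be replaced by \<open>i\<close>.\<close>
  define E where "E i j k l = monomial4 1 i j k l g" for i j k l
  have E: "monomial4 w i j k l g = w * E i j k l" for w i j k l
    by (simp add: E_def monomial4_def)
  have Es: "of_nat i * E (Suc (i - Suc 0)) j k 0 = of_nat i * E i j k 0"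
    "of_nat j * E i (Suc (j - Suc 0)) k 0 = of_nat j * E i j k 0"
    "of_nat k * E i j (Suc (k - Suc 0)) 0 = of_nat k * E i j k 0"
    by (cases i; cases j; cases k; simp)+
  have "T 1 g + T \<i> g = 4 * w * (of_nat i * (of_nat j * E (i - Suc 0) (j - Suc 0) (Suc k) (Suc 0)))
      - 2 * w * ((1 + of_nat k) * (of_nat i * E (Suc (i - Suc 0)) j k 0)
         + of_nat j * E i (Suc (j - Suc 0)) k 0 + (1 + of_nat i) * (of_nat k * E i j (Suc (k - Suc 0)) 0))"
    unfolding T_def S_def E by (simp add: algebra_simps)
  also have "\<dots> = of_nat (4 * i * j) * (w * (ca g ^ (i - 1) * cnj (ca g) ^ (j - 1) * cb g ^ k * (cb g * cnj (cb g))))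
      - of_nat (4 * i * k + 2 * (i + j + k)) * monomial w i j k g"
    unfolding Es m E by (simp add: E_def monomial4_def algebra_simps)
  also have "\<dots> = of_nat (4 * i * j) * monomial w (i - 1) (j - 1) k g
      - of_nat (4 * i * j + 4 * i * k + 2 * (i + j + k)) * monomial w i j k g"
    unfolding b monomial_def
    by (cases i; cases j) (simp_all add: algebra_simps)
  finally have "T 1 g + T \<i> g = of_real (real (4 * i * j)) * monomial w (i - 1) (j - 1) k g
      - of_real (real (4 * i * j + 4 * i * k + 2 * (i + j + k))) * monomial w i j k g"
    by simp
  then show "sub_laplacian (\<lambda>g. Re (monomial w i j k g)) g = 4 * real i * real j * Re (monomial w (i - 1) (j - 1) k g)
       - (4 * real i * real j + 4 * real i * real k + 2 * (real i + real j + real k)) * Re (monomial w i j k g)"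
    unfolding L by (simp del: of_real_of_nat_eq of_nat_add of_nat_mult) simp
qed

section \<open>Smoothness and compactness\<close>

lemma real_polynomial_function_has_derivative:
  fixes p :: "'a::euclidean_space \<Rightarrow> real"
  assumes "real_polynomial_function p"
  shows "\<exists>p'. (\<forall>x. (p has_derivative p' x) (at x)) \<and> (\<forall>v. real_polynomial_function (\<lambda>x. p' x v))"
  using assms
proof induction
  case (linear f)
  then show ?case
    by (intro exI[of _ "\<lambda>x. f"]) (auto intro: bounded_linear_imp_has_derivative)
next
  case (const c)
  then show ?case by (intro exI[of _ "\<lambda>x v. 0"]) auto
next
  case (add f g)
  then obtain f' g' where "\<forall>x. (f has_derivative f' x) (at x)" "\<forall>v. real_polynomial_function (\<lambda>x. f' x v)"
     "\<forall>x. (g has_derivative g' x) (at x)" "\<forall>v. real_polynomial_function (\<lambda>x. g' x v)" by blast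
  then show ?case
    by (intro exI[of _ "\<lambda>x v. f' x v + g' x v"]) (auto intro: has_derivative_add)
next
  case (mult f g)
  then obtain f' g' where "\<forall>x. (f has_derivative f' x) (at x)" "\<forall>v. real_polynomial_function (\<lambda>x. f' x v)"
     "\<forall>x. (g has_derivative g' x) (at x)" "\<forall>v. real_polynomial_function (\<lambda>x. g' x v)" by blast
  with mult.hyps show ?case
    by (intro exI[of _ "\<lambda>x v. f x * g' x v + f' x v * g x"]) (auto intro!: has_derivative_mult real_polynomial_function.intros(3,4))
qed

text \<open>The directional derivatives of a polynomial are polynomials, so induction on the order applies.\<close>

lemma real_polynomial_function_Ck:
  fixes p :: "'a::euclidean_space \<Rightarrow> real"
  assumes "real_polynomial_function p"
  shows "Ck k p"
  using assms
proof (induction k arbitrary: p)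
  case 0
  then show ?case by (simp add: continuous_on_polymonial_function real_polynomial_function_eq)
next
  case (Suc k)
  then show ?case using real_polynomial_function_has_derivative[OF Suc.prems] by fastforce
qed

text \<open>A complex form of \<^const>\<open>real_polynomial_function\<close>, introduced so that products and powers of
matrix entries need not be split into real and imaginary parts by hand.\<close>

definition complex_polynomial_function :: "('a::real_normed_vector \<Rightarrow> complex) \<Rightarrow> bool" where
  "complex_polynomial_function F \<longleftrightarrow> real_polynomial_function (\<lambda>x. Re (F x)) \<and> real_polynomial_function (\<lambda>x. Im (F x))"

lemma complex_polynomial_function_const: "complex_polynomial_function (\<lambda>_. c)"
  by (simp add: complex_polynomial_function_def real_polynomial_function.intros)

lemma complex_polynomial_function_mult: "complex_polynomial_function F \<Longrightarrow> complex_polynomial_function G \<Longrightarrow> complex_polynomial_function (\<lambda>x. F x * G x)"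
  unfolding complex_polynomial_function_def by (auto intro!: real_polynomial_function_diff real_polynomial_function.intros(3,4))

lemma complex_polynomial_function_power: "complex_polynomial_function F \<Longrightarrow> complex_polynomial_function (\<lambda>x. F x ^ n)"
  by (induction n) (auto intro: complex_polynomial_function_const complex_polynomial_function_mult)

lemma complex_polynomial_function_cnj: "complex_polynomial_function F \<Longrightarrow> complex_polynomial_function (\<lambda>x. cnj (F x))"
  unfolding complex_polynomial_function_def by (auto intro: real_polynomial_function_minus)

lemma complex_polynomial_function_nth: "complex_polynomial_function (\<lambda>A :: complex^2^2. A $ i $ j)"
proof -
  have "bounded_linear (\<lambda>A :: complex^2^2. A $ i $ j)"
    using bounded_linear_compose[OF bounded_linear_vec_nth bounded_linear_vec_nth] .
  then show ?thesis
    unfolding complex_polynomial_function_def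
    by (auto intro!: real_polynomial_function.intros
        bounded_linear_compose[OF bounded_linear_Re] bounded_linear_compose[OF bounded_linear_Im])
qed

lemma su2_smooth_monomial: "su2_smooth (\<lambda>g. Re (monomial w i j k g))"
proof -
  let ?F = "\<lambda>A :: complex^2^2. w * ((A$1$1)^i * cnj (A$1$1)^j * (A$1$2)^k)"
  have "complex_polynomial_function ?F"
    by (intro complex_polynomial_function_mult complex_polynomial_function_const complex_polynomial_function_power complex_polynomial_function_cnj complex_polynomial_function_nth)
  then have "Ck n (\<lambda>A. Re (?F A))" for n
    by (simp add: complex_polynomial_function_def real_polynomial_function_Ck)
  moreover have "(\<lambda>g. Re (monomial w i j k g)) = (\<lambda>A. Re (?F A)) \<circ> Rep_su2"
    by (simp add: fun_eq_iff monomial_def ca_def cb_def)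
  ultimately show ?thesis unfolding su2_smooth_def by blast
qed

lemma continuous_on_Rep_su2: "continuous_on S Rep_su2"
  unfolding continuous_on_iff by (auto simp: dist_su2_def)

lemma continuous_on_ca: "continuous_on S ca" and continuous_on_cb: "continuous_on S cb"
  using continuous_on_component[OF continuous_on_component[OF continuous_on_Rep_su2]]
  by (auto simp: ca_def[abs_def] cb_def[abs_def])

lemma continuous_on_monomial: "continuous_on S (monomial w i j k)"
  unfolding monomial_def[abs_def] by (intro continuous_intros continuous_on_ca continuous_on_cb)

lemma compact_SU2: "compact SU2"
proof -
  have "closed {A :: complex^2^2. A$2$1 = - cnj (A$1$2) \<and> A$2$2 = cnj (A$1$1) \<and>
     A$1$1 * cnj (A$1$1) + A$1$2 * cnj (A$1$2) = 1}"
    by (intro closed_Collect_conj closed_Collect_eq continuous_intros)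
  moreover have "bounded SU2"
  proof (rule boundedI)
    fix A assume A: "A \<in> SU2"
    then have "complex_of_real ((cmod (A$1$1))\<^sup>2 + (cmod (A$1$2))\<^sup>2) = 1"
      by (simp add: SU2_iff complex_mult_cnj cmod_power2)
    then have n: "(cmod (A$1$1))\<^sup>2 + (cmod (A$1$2))\<^sup>2 = 1" using of_real_eq_1_iff by blast
    have n1: "cmod (A$i$j) \<le> 1" for i j
    proof -
      have "(cmod (A$1$1))\<^sup>2 \<le> 1" "(cmod (A$1$2))\<^sup>2 \<le> 1"
        using n zero_le_power2[of "cmod (A$1$1)"] zero_le_power2[of "cmod (A$1$2)"] by linarith+
      then have "cmod (A$1$1) \<le> 1" "cmod (A$1$2) \<le> 1"
        by (simp_all add: power_le_one_iff abs_square_le_1)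
      then show ?thesis using A exhaust_2[of i] exhaust_2[of j] by (auto simp: SU2_iff)
    qed
    have n2: "norm (A $ i) \<le> 2" for i
    proof -
      have "norm (A $ i) \<le> (\<Sum>j\<in>UNIV. cmod (A$i$j))"
        unfolding norm_vec_def by (rule L2_set_le_sum) simp
      then show ?thesis using n1[of i 1] n1[of i 2] by (simp add: sum_2)
    qed
    have "norm A \<le> (\<Sum>i\<in>UNIV. norm (A$i))"
      unfolding norm_vec_def[of A] by (rule L2_set_le_sum) simp
    then show "norm A \<le> 4" using n2[of 1] n2[of 2] by (simp add: sum_2)
  qed
  moreover have "SU2 = {A :: complex^2^2. A$2$1 = - cnj (A$1$2) \<and> A$2$2 = cnj (A$1$1) \<and>
     A$1$1 * cnj (A$1$1) + A$1$2 * cnj (A$1$2) = 1}"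
    using SU2_iff by blast
  ultimately show ?thesis by (metis compact_eq_bounded_closed)
qed

section \<open>Eigenvectors of strongly continuous semigroups\<close>

text \<open>By Baire's theorem one of the closed sets on which all \<open>T n\<close> are bounded by \<open>N\<close> contains a ball;
translating the ball to the origin bounds the operator norms.\<close>

lemma uniform_boundedness_principle:
  fixes T :: "nat \<Rightarrow> 'a::banach \<Rightarrow>\<^sub>L 'b::real_normed_vector"
  assumes pw: "\<And>x. \<exists>M. \<forall>n. norm (T n x) \<le> M"
  shows "\<exists>M. \<forall>n. norm (T n) \<le> M"
proof -
  define C where "C N = {x. \<forall>n. norm (T n x) \<le> real N}" for N :: nat
  have closed: "closed (C N)" for N
    unfolding C_def by (intro closed_Collect_all closed_Collect_le continuous_intros)
  have "\<exists>N. x \<in> C N" for x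
  proof -
    obtain M where "\<forall>n. norm (T n x) \<le> M" using pw by blast
    moreover obtain N where "M \<le> real N" using real_arch_simple by blast
    ultimately show ?thesis by (auto simp: C_def intro: order_trans)
  qed
  then have U: "\<Union>(range C) = UNIV" by blast
  have "\<exists>N. interior (C N) \<noteq> {}"
  proof (rule ccontr)
    assume "\<not> ?thesis"
    then have "(euclidean :: 'a topology) interior_of \<Union>(range C) = {}"
      using closed by (intro Baire_category_alt) (auto simp: completely_metrizable_space_euclidean)
    then show False by (simp add: U)
  qed
  then obtain N x0 where "x0 \<in> interior (C N)" by blast
  then obtain e where e: "e > 0" "cball x0 e \<subseteq> C N"
    using mem_interior_cball by blast
  have "norm (T n) \<le> 2 * real N / e" for n
  proof (rule norm_blinfun_bound)
    fix y
    show "norm (T n y) \<le> 2 * real N / e * norm y"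
    proof (cases "y = 0")
      case False
      \<comment> \<open>rescale to norm \<open>e\<close>, so that \<open>x0 + u\<close> stays in the ball\<close>
      define u where "u = (e / norm y) *\<^sub>R y"
      have "x0 + u \<in> cball x0 e" "x0 \<in> cball x0 e"
        using e False by (auto simp: u_def dist_norm)
      then have "x0 + u \<in> C N" "x0 \<in> C N"
        using e(2) by blast+
      then have "norm (T n (x0 + u)) \<le> N" "norm (T n x0) \<le> N"
        by (auto simp: C_def)
      moreover have "T n u = T n (x0 + u) - T n x0"
        by (simp add: blinfun.add_right)
      ultimately have "norm (T n u) \<le> 2 * N"
        using norm_triangle_ineq4[of "T n (x0 + u)" "T n x0"] by simp
      then have "e / norm y * norm (T n y) \<le> 2 * N"
        using e by (simp add: u_def blinfun.scaleR_right)
      then show ?thesis using e False by (simp add: field_simps)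
    qed simp
  qed (use e in simp)
  then show ?thesis by blast
qed

text \<open>If the norms were unbounded near 0, there would be times \<open>s n\<close> tending to 0 with unbounded norms,
although \<open>P (s n) f\<close> converges for every \<open>f\<close>: this contradicts uniform boundedness. The semigroup
law carries the bound from a neighbourhood of 0 to all of \<open>[0, T]\<close>.\<close>

lemma C0_semigroup_locally_bounded:
  fixes P :: "real \<Rightarrow> 'a::banach \<Rightarrow>\<^sub>L 'a"
  assumes P: "C0_semigroup P"
  shows "\<exists>M. \<forall>t\<in>{0..T}. norm (P t) \<le> M"
proof -
  have P0: "P 0 = id_blinfun" and Padd: "\<And>s t. s \<ge> 0 \<Longrightarrow> t \<ge> 0 \<Longrightarrow> P (s + t) = P s o\<^sub>L P t"
    and Plim: "\<And>f. ((\<lambda>t. P t f) \<longlongrightarrow> f) (at_right 0)"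
    using P by (auto simp: C0_semigroup_def)
  have "\<exists>n::nat. \<forall>t. 0 \<le> t \<and> t < 1 / real (Suc n) \<longrightarrow> norm (P t) \<le> real n"
  proof (rule ccontr)
    assume "\<not> ?thesis"
    then have "\<forall>n. \<exists>t. 0 \<le> t \<and> t < 1 / real (Suc n) \<and> norm (P t) > real n"
      by (meson not_le)
    then obtain s where s: "\<And>n. 0 \<le> s n" "\<And>n. s n < 1 / real (Suc n)" "\<And>n. norm (P (s n)) > real n"
      by metis
    have s0: "s \<longlonglongrightarrow> 0"
    proof (rule tendsto_sandwich[of "\<lambda>_. 0" s _ "\<lambda>n. 1 / real (Suc n)"])
      show "(\<lambda>n. 1 / real (Suc n)) \<longlonglongrightarrow> 0" using LIMSEQ_Suc[OF lim_1_over_n] by simp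
    qed (use s in \<open>auto intro!: always_eventually less_imp_le\<close>)
    have "\<exists>M. \<forall>n. norm (P (s n) f) \<le> M" for f
    proof -
      have "(\<lambda>n. P (s n) f) \<longlonglongrightarrow> f"
      proof (rule metric_LIMSEQ_I)
        fix e :: real assume e: "e > 0"
        have "eventually (\<lambda>t. dist (P t f) f < e) (at_right 0)"
          using Plim[of f] e by (rule tendstoD)
        then obtain b where b: "b > 0" "\<And>t. 0 < t \<Longrightarrow> t < b \<Longrightarrow> dist (P t f) f < e"
          by (auto simp: eventually_at_right_field)
        have "eventually (\<lambda>n. s n < b) sequentially"
          using s0 b(1) by (rule order_tendstoD)
        then obtain N where N: "\<And>n. n \<ge> N \<Longrightarrow> s n < b" by (auto simp: eventually_sequentially)
        have "dist (P (s n) f) f < e" if "n \<ge> N" for n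
          using b(2)[of "s n"] N[OF that] s(1)[of n] e P0 by (cases "s n = 0") auto
        then show "\<exists>N. \<forall>n\<ge>N. dist (P (s n) f) f < e" by blast
      qed
      then have "Bseq (\<lambda>n. P (s n) f)"
        by (intro convergent_imp_Bseq convergentI)
      then show ?thesis by (auto simp: Bseq_def)
    qed
    then obtain M where "\<forall>n. norm (P (s n)) \<le> M"
      using uniform_boundedness_principle[of "\<lambda>n. P (s n)"] by blast
    moreover obtain n where "M \<le> real n" using real_arch_simple by blast
    ultimately show False using s(3)[of n] by (meson order_trans not_le)
  qed
  then obtain n :: nat where n: "\<And>t. 0 \<le> t \<Longrightarrow> t < 1 / real (Suc n) \<Longrightarrow> norm (P t) \<le> real n" by blast
  have pw: "norm (P (real k * t)) \<le> max 1 (real n) ^ k" if "0 \<le> t" "t < 1 / real (Suc n)" for k t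
  proof (induction k)
    case 0 then show ?case by (simp add: P0 norm_blinfun_id_le)
  next
    case (Suc k)
    have "P (real (Suc k) * t) = P t o\<^sub>L P (real k * t)"
      using Padd[of t "real k * t"] that by (simp add: algebra_simps)
    then have "norm (P (real (Suc k) * t)) \<le> norm (P t) * norm (P (real k * t))"
      by (simp add: norm_blinfun_compose)
    also have "\<dots> \<le> max 1 (real n) * max 1 (real n) ^ k"
      using n[OF that] Suc by (intro mult_mono) auto
    finally show ?case by simp
  qed
  obtain N :: nat where N: "T * real (Suc n) < real N" using reals_Archimedean2 by blast
  have "norm (P t) \<le> max 1 (real n) ^ Suc N" if "t \<in> {0..T}" for t
  proof -
    have "t * real (Suc n) \<le> T * real (Suc n)"
      using that by (intro mult_right_mono) auto
    also have "\<dots> < real (Suc N)" using N by linarith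
    finally have "t * real (Suc n) < real (Suc N)" .
    then have "t / real (Suc N) < 1 / real (Suc n)"
      by (simp add: field_simps)
    then show ?thesis
      using pw[of "t / real (Suc N)" "Suc N"] that by simp
  qed
  then show ?thesis by blast
qed

text \<open>The vector \<open>f\<close> need only be an eigenvector up to an error \<open>w\<close> that the functional \<open>\<phi>\<close> does not see
along the semigroup; \<open>w = 0\<close> gives true eigenvectors, and nonzero \<open>w\<close> serves triangular systems.
The quantity \<open>exp (- l t) \<phi>(P\<^sub>t f)\<close> is shown to be constant by telescoping over \<open>n\<close> steps of length
\<open>h = T/n\<close>. One step changes it by at most a constant times \<open>h\<close> times the distance from \<open>w\<close> of the
difference quotient of \<open>exp (- l h) P\<^sub>h f\<close>. The \<open>n\<close> errors add up to \<open>T\<close> times a quantity tending to 0.\<close>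

lemma C0_semigroup_eigenvector:
  fixes P :: "real \<Rightarrow> 'a::banach \<Rightarrow>\<^sub>L 'a" and \<phi> :: "'a \<Rightarrow> real"
  assumes P: "C0_semigroup P" and gen: "(f, l *\<^sub>R f + w) \<in> generator P"
    and \<phi>: "bounded_linear \<phi>" and w: "\<And>t. t \<ge> 0 \<Longrightarrow> \<phi> (P t w) = 0" and T: "T \<ge> 0"
  shows "\<phi> (P T f) = exp (l * T) * \<phi> f"
proof -
  interpret \<phi>: bounded_linear \<phi> by fact
  have P0: "P 0 = id_blinfun" and Padd: "\<And>s t. s \<ge> 0 \<Longrightarrow> t \<ge> 0 \<Longrightarrow> P (s + t) = P s o\<^sub>L P t"
    using P by (auto simp: C0_semigroup_def)
  obtain M where M: "\<And>t. t \<in> {0..T} \<Longrightarrow> norm (P t) \<le> M"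
    using C0_semigroup_locally_bounded[OF P, of T] by blast
  have M0: "M \<ge> 0" using M[of 0] T norm_ge_zero[of "P 0"] by (auto simp del: norm_ge_zero)
  obtain K where K: "K \<ge> 0" "\<And>x. norm (\<phi> x) \<le> norm x * K"
    using \<phi>.nonneg_bounded by blast
  \<comment> \<open>the difference quotient at 0 of \<open>exp (- l h) P\<^sub>h f\<close>; its limit is \<open>-l f + (l f + w) = w\<close>\<close>
  define D where "D h = (1 / h) *\<^sub>R (exp (- l * h) *\<^sub>R P h f - f)" for h
  have D: "(D \<longlongrightarrow> w) (at_right 0)"
  proof -
    have "((\<lambda>h. (exp (- l * h) - 1) / h) \<longlongrightarrow> - l) (at_right 0)"
    proof -
      have "((\<lambda>h. exp (- l * h)) has_real_derivative (- l)) (at 0)"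
        by (auto intro!: derivative_eq_intros)
      then have "((\<lambda>h. (exp (- l * h) - 1) / h) \<longlongrightarrow> - l) (at 0)"
        by (simp add: has_field_derivative_iff)
      then show ?thesis by (rule tendsto_mono[rotated]) (simp add: at_le)
    qed
    moreover have "((\<lambda>h. exp (- l * h)) \<longlongrightarrow> 1) (at_right 0)"
      by (auto intro!: tendsto_eq_intros)
    moreover have "((\<lambda>h. (1 / h) *\<^sub>R (P h f - f)) \<longlongrightarrow> l *\<^sub>R f + w) (at_right 0)"
      using gen by (simp add: generator_def)
    ultimately have "((\<lambda>h. exp (- l * h) *\<^sub>R ((1 / h) *\<^sub>R (P h f - f)) + ((exp (- l * h) - 1) / h) *\<^sub>R f)
        \<longlongrightarrow> 1 *\<^sub>R (l *\<^sub>R f + w) + (- l) *\<^sub>R f) (at_right 0)"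
      by (intro tendsto_intros)
    moreover have "(\<lambda>h. exp (- l * h) *\<^sub>R ((1 / h) *\<^sub>R (P h f - f)) + ((exp (- l * h) - 1) / h) *\<^sub>R f) = D"
      by (auto simp: fun_eq_iff D_def algebra_simps diff_divide_distrib)
    ultimately show ?thesis by simp
  qed
  have bound: "\<bar>exp (- l * T) * \<phi> (P T f) - \<phi> f\<bar>
      \<le> T * (exp (\<bar>l\<bar> * T) * (M * K)) * norm (D (T / real (Suc n)) - w)" for n
  proof -
    define h where "h = T / real (Suc n)"
    have h0: "h \<ge> 0" using T by (simp add: h_def)
    define x where "x j = exp (- l * (real j * h)) * \<phi> (P (real j * h) f)" for j :: nat
    have step: "\<bar>x (Suc j) - x j\<bar> \<le> exp (\<bar>l\<bar> * T) * (M * K) * (h * norm (D h - w))" if "j < Suc n" for j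
    proof -
      define s where "s = real j * h"
      have s: "0 \<le> s" "s \<le> T"
        using that T mult_left_mono[of "real j" "real (Suc n)" T]
        by (auto simp: s_def h_def field_simps)
      have "P (real (Suc j) * h) = P s o\<^sub>L P h"
        using Padd[OF s(1) h0] by (simp add: s_def algebra_simps)
      then have "x (Suc j) = exp (- l * s) * \<phi> (P s (exp (- l * h) *\<^sub>R P h f))"
        by (simp add: x_def s_def algebra_simps exp_add[symmetric] blinfun.scaleR_right \<phi>.scaleR)
      moreover have "x j = exp (- l * s) * \<phi> (P s f)" by (simp add: x_def s_def)
      ultimately have "x (Suc j) - x j = exp (- l * s) * \<phi> (P s (exp (- l * h) *\<^sub>R P h f - f))"
        by (simp add: blinfun.diff_right \<phi>.diff algebra_simps)
      also have "exp (- l * h) *\<^sub>R P h f - f = h *\<^sub>R D h"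
        by (cases "h = 0") (simp_all add: D_def P0)
      \<comment> \<open>subtracting \<open>h w\<close> is free, as \<open>\<phi>\<close> vanishes on \<open>P\<^sub>s w\<close>, and makes the argument \<open>o(h)\<close>\<close>
      also have "\<phi> (P s (h *\<^sub>R D h)) = \<phi> (P s (h *\<^sub>R (D h - w)))"
        using w[OF s(1)] by (simp add: blinfun.scaleR_right blinfun.diff_right \<phi>.diff \<phi>.scaleR)
      finally have "\<bar>x (Suc j) - x j\<bar> = exp (- l * s) * norm (\<phi> (P s (h *\<^sub>R (D h - w))))"
        by (simp add: abs_mult)
      also have "\<dots> \<le> exp (\<bar>l\<bar> * T) * (M * norm (h *\<^sub>R (D h - w)) * K)"
      proof (rule mult_mono)
        have "\<bar>l * s\<bar> \<le> \<bar>l\<bar> * T" using s by (simp add: abs_mult mult_left_mono)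
        then show "exp (- l * s) \<le> exp (\<bar>l\<bar> * T)" by simp
        have "norm (P s (h *\<^sub>R (D h - w))) \<le> M * norm (h *\<^sub>R (D h - w))"
          using norm_blinfun[of "P s" "h *\<^sub>R (D h - w)"] M[of s] s mult_right_mono[of "norm (P s)" M "norm (h *\<^sub>R (D h - w))"]
          by auto
        then show "norm (\<phi> (P s (h *\<^sub>R (D h - w)))) \<le> M * norm (h *\<^sub>R (D h - w)) * K"
          using K(2)[of "P s (h *\<^sub>R (D h - w))"] mult_right_mono[OF _ K(1)] by (meson order_trans)
      qed auto
      also have "\<dots> = exp (\<bar>l\<bar> * T) * (M * K) * (h * norm (D h - w))"
        using h0 by simp
      finally show ?thesis .
    qed
    have "\<bar>x (Suc n) - x 0\<bar> = \<bar>\<Sum>j<Suc n. x (Suc j) - x j\<bar>"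
      by (subst sum_lessThan_telescope) simp
    also have "\<dots> \<le> (\<Sum>j<Suc n. \<bar>x (Suc j) - x j\<bar>)" by (rule sum_abs)
    also have "\<dots> \<le> (\<Sum>j<Suc n. exp (\<bar>l\<bar> * T) * (M * K) * (h * norm (D h - w)))"
      by (rule sum_mono) (use step in auto)
    also have "\<dots> = real (Suc n) * h * (exp (\<bar>l\<bar> * T) * (M * K)) * norm (D h - w)" by simp
    also have "real (Suc n) * h = T" by (simp add: h_def)
    finally show ?thesis by (simp add: x_def P0 h_def)
  qed
  have "(\<lambda>n. D (T / real (Suc n))) \<longlonglongrightarrow> w" if "T > 0"
  proof -
    have "filterlim (\<lambda>n. T / real (Suc n)) (at_right 0) sequentially"
      unfolding filterlim_at
    proof
      show "(\<lambda>n. T / real (Suc n)) \<longlonglongrightarrow> 0"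
        using tendsto_mult_right[OF LIMSEQ_Suc[OF lim_1_over_n], of T] by simp
    qed (use that in auto)
    then show ?thesis using D filterlim_compose by blast
  qed
  then have "T > 0 \<Longrightarrow> (\<lambda>n. norm (D (T / real (Suc n)) - w)) \<longlonglongrightarrow> 0"
    using tendsto_norm[OF LIM_zero] by fastforce
  then have "T > 0 \<Longrightarrow> (\<lambda>n. T * (exp (\<bar>l\<bar> * T) * (M * K)) * norm (D (T / real (Suc n)) - w)) \<longlonglongrightarrow> 0"
    by (intro tendsto_mult_right_zero)
  then have "T > 0 \<Longrightarrow> \<bar>exp (- l * T) * \<phi> (P T f) - \<phi> f\<bar> \<le> 0"
    using bound by (intro LIMSEQ_le_const[of _ 0]) auto
  then have "exp (- l * T) * \<phi> (P T f) = \<phi> f"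
    using T P0 by (cases "T = 0") auto
  then show ?thesis by (simp add: exp_minus field_simps)
qed

lemma generator_scaleR:
  assumes "(f, g) \<in> generator P" shows "(c *\<^sub>R f, c *\<^sub>R g) \<in> generator P"
proof -
  have "((\<lambda>t. c *\<^sub>R ((1 / t) *\<^sub>R (P t f - f))) \<longlongrightarrow> c *\<^sub>R g) (at_right 0)"
    using assms by (intro tendsto_scaleR tendsto_const) (simp add: generator_def)
  then show ?thesis by (simp add: generator_def blinfun.scaleR_right scaleR_diff_right mult.commute)
qed

lemma generator_sum:
  assumes "\<And>i. i \<in> I \<Longrightarrow> (f i, g i) \<in> generator P"
  shows "((\<Sum>i\<in>I. f i), (\<Sum>i\<in>I. g i)) \<in> generator P"
proof -
  have "((\<lambda>t. \<Sum>i\<in>I. (1 / t) *\<^sub>R (P t (f i) - f i)) \<longlongrightarrow> (\<Sum>i\<in>I. g i)) (at_right 0)"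
    using assms by (auto simp: generator_def intro!: tendsto_intros)
  then show ?thesis
    by (simp add: generator_def blinfun.sum_right scaleR_sum_right[symmetric] sum_subtractf[symmetric])
qed

section \<open>Jacobi polynomials in the variable u = (1 + x) / 2\<close>

text \<open>The coefficient of \<open>u^s\<close> in the Jacobi polynomial with parameters \<open>(0, m)\<close> and degree \<open>k\<close>, taken
at \<open>2u - 1\<close>. In this variable the weight is \<open>u^m\<close> on \<open>[0, 1]\<close>, and \<open>cos 2r\<close> corresponds to
\<open>u = cos\<^sup>2 r\<close>.\<close>

definition jacobi_coeff :: "nat \<Rightarrow> nat \<Rightarrow> nat \<Rightarrow> real" where
  "jacobi_coeff m k s = (-1) ^ (k + s) * real (k choose s) * real ((m + k + s) choose k)"

definition jacobi_poly :: "nat \<Rightarrow> nat \<Rightarrow> real poly" where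
  "jacobi_poly m k = (\<Sum>s\<le>k. monom (jacobi_coeff m k s) s)"

definition rodrigues_poly :: "nat \<Rightarrow> nat \<Rightarrow> real poly" where
  "rodrigues_poly m k = [:0, 1:] ^ (m + k) * [:1, -1:] ^ k"

lemma rodrigues_poly_sum:
  "rodrigues_poly m k = (\<Sum>s\<le>k. monom ((-1) ^ s * real (k choose s)) (m + k + s))"
proof -
  have "[:1, -1:] ^ k = ([:0, -1:] + 1 :: real poly) ^ k" by (simp add: one_pCons)
  also have "\<dots> = (\<Sum>s\<le>k. of_nat (k choose s) * [:0, -1:] ^ s)"
    by (simp add: binomial_ring)
  also have "\<dots> = (\<Sum>s\<le>k. monom ((-1) ^ s * real (k choose s)) s)"
  proof (rule sum.cong)
    fix s
    have "[:0, -1:] ^ s = (monom (-1) 1 :: real poly) ^ s" by (simp add: monom_altdef)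
    then show "of_nat (k choose s) * [:0, -1:] ^ s = monom ((-1) ^ s * real (k choose s)) s"
      by (simp add: monom_power of_nat_poly smult_monom mult.commute)
  qed simp
  finally have "rodrigues_poly m k = monom 1 (m + k) * (\<Sum>s\<le>k. monom ((-1) ^ s * real (k choose s)) s)"
    by (simp add: rodrigues_poly_def monom_altdef)
  then show ?thesis by (simp add: sum_distrib_left mult_monom)
qed

text \<open>Rodrigues' formula: expand \<open>u^(m+k) (1 - u)^k\<close> by the binomial theorem and differentiate termwise.\<close>

lemma higher_pderiv_rodrigues:
  "(pderiv ^^ k) (rodrigues_poly m k) = smult ((-1) ^ k * fact k) (monom 1 m * jacobi_poly m k)"
proof -
  have "(pderiv ^^ k) (rodrigues_poly m k)
      = (\<Sum>s\<le>k. (pderiv ^^ k) (monom ((-1) ^ s * real (k choose s)) (m + k + s)))"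
    by (simp add: rodrigues_poly_sum higher_pderiv_sum)
  also have "\<dots> = (\<Sum>s\<le>k. smult ((-1) ^ k * fact k) (monom 1 m * monom (jacobi_coeff m k s) s))"
  proof (rule sum.cong)
    fix s
    have "pochhammer (real (m + s) + 1) k = fact k * real ((m + k + s) choose k)"
    proof -
      have "pochhammer (real (m + s) + 1) k = fact (m + s + k) / fact (m + s)"
      proof -
        have "fact (m + s + k) = (fact (m + s) :: real) * pochhammer (real (m + s) + 1) k"
          using pochhammer_product'[of "1 :: real" "m + s" k] by (simp only: pochhammer_fact add.commute)
        then show ?thesis by (simp add: field_simps)
      qed
      also have "\<dots> = fact k * real ((m + k + s) choose k)"
        by (simp add: binomial_fact add_ac)
      finally show ?thesis .
    qed
    moreover have "(pderiv ^^ k) (monom c (m + k + s)) = monom (pochhammer (real (m + s) + 1) k * c) (m + s)" for c :: real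
      by (rule poly_eqI) (auto simp: coeff_higher_pderiv add_ac)
    ultimately show "(pderiv ^^ k) (monom ((-1) ^ s * real (k choose s)) (m + k + s))
        = smult ((-1) ^ k * fact k) (monom 1 m * monom (jacobi_coeff m k s) s)"
      by (simp add: jacobi_coeff_def mult_monom smult_monom power_add mult_ac)
  qed simp
  also have "\<dots> = smult ((-1) ^ k * fact k) (\<Sum>s\<le>k. monom 1 m * monom (jacobi_coeff m k s) s)"
    by (induction rule: infinite_finite_induct) (simp_all add: smult_add_right)
  finally show ?thesis
    by (simp add: jacobi_poly_def sum_distrib_left)
qed

lemma power_dvd_higher_pderiv:
  fixes W :: "real poly"
  assumes "W ^ (n + k) dvd R"
  shows "W ^ n dvd (pderiv ^^ k) R"
  using assms
proof (induction k arbitrary: n)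
  case (Suc k)
  then have "W ^ Suc n dvd (pderiv ^^ k) R" using Suc.IH[of "Suc n"] by simp
  then obtain S where "(pderiv ^^ k) R = W ^ Suc n * S" by (elim dvdE)
  then have "(pderiv ^^ Suc k) R = W ^ n * (W * pderiv S + smult (of_nat (Suc n)) (pderiv W) * S)"
    by (simp only: funpow.simps o_apply pderiv_mult pderiv_power_Suc) (simp add: algebra_simps)
  then show ?case by (metis dvd_triv_left)
qed simp

text \<open>All derivatives must fall on the factor \<open>(x - c)^k\<close> for a term to survive at \<open>c\<close>.\<close>

lemma higher_pderiv_root:
  fixes S :: "real poly"
  shows "poly ((pderiv ^^ k) ([:-c, 1:] ^ k * S)) c = fact k * poly S c"
proof (induction k arbitrary: S)
  case (Suc k)
  have "pderiv ([:-c, 1:] ^ Suc k * S) = [:-c, 1:] ^ k * (smult (of_nat (Suc k)) S + [:-c, 1:] * pderiv S)"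
    by (simp only: pderiv_mult pderiv_power_Suc) (simp add: pderiv_pCons algebra_simps)
  then have "(pderiv ^^ Suc k) ([:-c, 1:] ^ Suc k * S)
      = (pderiv ^^ k) ([:-c, 1:] ^ k * (smult (of_nat (Suc k)) S + [:-c, 1:] * pderiv S))"
    by (simp add: funpow_Suc_right del: funpow.simps)
  then show ?case using Suc.IH by simp
qed simp

text \<open>The normalisation at \<open>u = 1\<close>, that is at \<open>r = 0\<close>: it gives the value of the eigenfunctions at the
identity of the group.\<close>

lemma jacobi_poly_1: "poly (jacobi_poly m k) 1 = 1"
proof -
  have "rodrigues_poly m k = [:-1, 1:] ^ k * smult ((-1) ^ k) ([:0, 1:] ^ (m + k))"
  proof -
    have "[:1, -1:] ^ k = (smult (-1) [:-1, 1:] :: real poly) ^ k" by simp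
    also have "\<dots> = smult ((-1) ^ k) ([:-1, 1:] ^ k)" by (simp only: smult_power)
    finally show ?thesis by (simp add: rodrigues_poly_def mult.commute)
  qed
  then have "poly ((pderiv ^^ k) (rodrigues_poly m k)) 1 = fact k * (-1) ^ k"
    by (simp only: higher_pderiv_root) simp
  then have "(-1) ^ k * fact k * poly (jacobi_poly m k) 1 = fact k * (-1) ^ k"
    by (simp add: higher_pderiv_rodrigues poly_monom)
  then show ?thesis by simp
qed

definition poly_integral :: "real poly \<Rightarrow> real" where
  "poly_integral p = integral {0..1} (poly p)"

lemma poly_integrable: "poly p integrable_on {0..1::real}" for p :: "real poly"
  by (rule integrable_continuous_interval) (intro continuous_intros)

lemma poly_integral_0: "poly_integral 0 = 0"
proof -
  have "poly (0 :: real poly) = (\<lambda>_. 0)" by auto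
  then show ?thesis by (simp only: poly_integral_def integral_0)
qed

lemma poly_integral_add: "poly_integral (p + q) = poly_integral p + poly_integral q"
  by (simp add: poly_integral_def poly_add[abs_def] integral_add poly_integrable)

lemma poly_integral_smult: "poly_integral (smult c p) = c * poly_integral p"
  by (simp add: poly_integral_def poly_smult[abs_def])

lemma poly_integral_diff: "poly_integral (p - q) = poly_integral p - poly_integral q"
  by (simp add: poly_integral_def poly_diff[abs_def] integral_diff poly_integrable)

lemma poly_integral_pderiv: "poly_integral (pderiv p) = poly p 1 - poly p 0"
proof -
  have "(poly (pderiv p) has_integral poly p 1 - poly p 0) {0..1}"
    by (intro fundamental_theorem_of_calculus)
       (auto simp: has_real_derivative_iff_has_vector_derivative[symmetric] intro: has_field_derivative_at_within)
  then show ?thesis by (simp add: poly_integral_def integral_unique)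
qed

text \<open>Each derivative of \<open>R\<close> of order less than \<open>k\<close> still has zeros at 0 and 1, so no boundary terms
appear.\<close>

lemma poly_integral_by_parts:
  assumes "([:0, 1:] * [:1, -1:]) ^ k dvd R"
  shows "poly_integral ((pderiv ^^ k) R * Q) = (-1) ^ k * poly_integral (R * (pderiv ^^ k) Q)"
  using assms
proof (induction k arbitrary: Q)
  case (Suc k)
  let ?W = "[:0, 1:] * [:1, -1:] :: real poly"
  let ?S = "(pderiv ^^ k) R"
  have "?W ^ 1 dvd ?S" by (rule power_dvd_higher_pderiv) (use Suc.prems in simp)
  then obtain U where U: "?S = ?W * U" by (auto elim!: dvdE simp del: mult_pCons_left)
  have "poly ?S 0 = 0" "poly ?S 1 = 0" unfolding U by simp_all
  then have "poly_integral (pderiv (?S * Q)) = 0" by (simp add: poly_integral_pderiv)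
  then have "poly_integral ((pderiv ^^ Suc k) R * Q) = - poly_integral (?S * pderiv Q)"
    by (simp add: pderiv_mult poly_integral_add mult.commute)
  also have "?W ^ k dvd R" using Suc.prems by (meson dvd_trans le_imp_power_dvd le_SucI order_refl)
  then have "poly_integral (?S * pderiv Q) = (-1) ^ k * poly_integral (R * (pderiv ^^ k) (pderiv Q))"
    by (rule Suc.IH)
  finally show ?case by (simp add: funpow_Suc_right del: funpow.simps)
qed simp

text \<open>The Beta integral at integer arguments; integrating the derivative of \<open>u^(a+1) (1 - u)^(b+1)\<close> lowers
\<open>b\<close> at the expense of \<open>a\<close>.\<close>

lemma poly_integral_beta:
  "poly_integral ([:0, 1:] ^ a * [:1, -1:] ^ b) = fact a * fact b / fact (a + b + 1)"
proof (induction b arbitrary: a)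
  case 0
  have "pderiv (smult (1 / real (Suc a)) ([:0, 1:] ^ Suc a)) = [:0, 1:] ^ a"
    by (simp only: pderiv_smult pderiv_power_Suc) (simp add: pderiv_pCons)
  then show ?case
    using poly_integral_pderiv[of "smult (1 / real (Suc a)) ([:0, 1:] ^ Suc a)"] by simp
next
  case (Suc b)
  let ?X = "[:0, 1:] :: real poly" and ?Y = "[:1, -1:] :: real poly"
  have "pderiv (?X ^ Suc a * ?Y ^ Suc b) =
      smult (real (Suc a)) (?X ^ a * ?Y ^ Suc b) - smult (real (Suc b)) (?X ^ Suc a * ?Y ^ b)"
    by (intro poly_eq_poly_eq_iff[THEN iffD1] ext, simp only: pderiv_mult pderiv_power_Suc)
       (simp add: pderiv_pCons algebra_simps)
  then have "real (Suc a) * poly_integral (?X ^ a * ?Y ^ Suc b)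
      = real (Suc b) * poly_integral (?X ^ Suc a * ?Y ^ b)"
    using poly_integral_pderiv[of "?X ^ Suc a * ?Y ^ Suc b"]
    by (simp add: poly_integral_diff poly_integral_smult del: power_Suc of_nat_Suc)
  then have "poly_integral (?X ^ a * ?Y ^ Suc b)
      = real (Suc b) * (fact (Suc a) * fact b / fact (Suc a + b + 1)) / real (Suc a)"
    unfolding Suc.IH by (simp add: field_simps del: of_nat_Suc)
  moreover have "real (Suc b) * (fact (Suc a) * fact b / x) / real (Suc a) = fact a * fact (Suc b) / x" for x
    by (simp add: fact_Suc del: of_nat_Suc)
  moreover have "Suc a + b + 1 = a + Suc b + 1" by simp
  ultimately show ?case by (simp only:)
qed

lemma coeff_jacobi_poly: "coeff (jacobi_poly m k) s = (if s \<le> k then jacobi_coeff m k s else 0)"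
  by (simp add: jacobi_poly_def coeff_sum)

lemma jacobi_coeff_top: "jacobi_coeff m k k = real ((m + 2 * k) choose k)"
  by (simp add: jacobi_coeff_def mult_2 add.assoc[symmetric] power_add[symmetric])

lemma poly_integral_rodrigues:
  "poly_integral (monom 1 m * jacobi_poly m k * Q)
    = poly_integral (rodrigues_poly m k * (pderiv ^^ k) Q) / fact k"
proof -
  have "([:0, 1:] ^ k * [:1, -1:] ^ k :: real poly) dvd ([:0, 1:] ^ m * [:0, 1:] ^ k) * [:1, -1:] ^ k"
    by (intro mult_dvd_mono dvd_triv_right dvd_refl)
  then have "([:0, 1:] * [:1, -1:]) ^ k dvd rodrigues_poly m k"
    by (simp only: rodrigues_poly_def power_mult_distrib power_add)
  from poly_integral_by_parts[OF this, of Q]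
  have "(-1) ^ k * (fact k * poly_integral (monom 1 m * jacobi_poly m k * Q))
      = (-1) ^ k * poly_integral (rodrigues_poly m k * (pderiv ^^ k) Q)"
    by (simp only: higher_pderiv_rodrigues poly_integral_smult mult_smult_left mult.assoc)
  then have "fact k * poly_integral (monom 1 m * jacobi_poly m k * Q)
      = poly_integral (rodrigues_poly m k * (pderiv ^^ k) Q)"
    by (subst (asm) mult_cancel_left) simp
  then show ?thesis by (metis fact_nonzero nonzero_mult_div_cancel_left)
qed

lemma jacobi_orthogonal_less:
  assumes "j < k"
  shows "poly_integral (monom 1 m * jacobi_poly m k * jacobi_poly m j) = 0"
proof -
  have "(pderiv ^^ k) (jacobi_poly m j) = 0"
    by (intro poly_eqI) (use assms in \<open>simp add: coeff_higher_pderiv coeff_jacobi_poly\<close>)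
  then show ?thesis by (simp add: poly_integral_rodrigues poly_integral_0)
qed

text \<open>Moving the \<open>k\<close> derivatives of Rodrigues' formula onto the other factor kills polynomials of lower
degree. On the Jacobi polynomial itself they leave \<open>k!\<close> times its leading coefficient, and a Beta
integral remains.\<close>

lemma jacobi_orthogonal:
  "poly_integral (monom 1 m * jacobi_poly m k * jacobi_poly m j)
    = (if j = k then 1 / (2 * real k + real m + 1) else 0)"
proof -
  have "poly_integral (monom 1 m * jacobi_poly m k * jacobi_poly m k) = 1 / (2 * real k + real m + 1)"
  proof -
    have "(pderiv ^^ k) (jacobi_poly m k) = [:fact k * real ((m + 2 * k) choose k):]"
    proof (rule poly_eqI)
      fix i
      show "coeff ((pderiv ^^ k) (jacobi_poly m k)) i = coeff [:fact k * real ((m + 2 * k) choose k):] i"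
        by (cases i) (auto simp: coeff_higher_pderiv coeff_jacobi_poly jacobi_coeff_top pochhammer_fact[symmetric])
    qed
    then have "rodrigues_poly m k * (pderiv ^^ k) (jacobi_poly m k)
        = smult (fact k * real ((m + 2 * k) choose k)) (rodrigues_poly m k)"
      by simp
    then have "poly_integral (monom 1 m * jacobi_poly m k * jacobi_poly m k)
        = real ((m + 2 * k) choose k) * poly_integral (rodrigues_poly m k)"
      by (simp only: poly_integral_rodrigues poly_integral_smult) simp
    also have "\<dots> = real ((m + 2 * k) choose k) * (fact (m + k) * fact k / fact (m + 2 * k + 1))"
      unfolding rodrigues_poly_def poly_integral_beta by (simp only: mult_2 add.assoc)
    also have "\<dots> = 1 / (2 * real k + real m + 1)"
    proof -
      have b: "fact k * fact (m + k) * ((m + 2 * k) choose k) = (fact (m + 2 * k) :: nat)"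
        using binomial_fact_lemma[of k "m + 2 * k"] by (simp add: add.commute)
      have "real ((m + 2 * k) choose k) * (fact (m + k) * fact k) = fact (m + 2 * k)"
        using arg_cong[OF b, of real] by (simp only: of_nat_mult of_nat_fact mult_ac)
      moreover have "(fact (m + 2 * k + 1) :: real) = (2 * real k + real m + 1) * fact (m + 2 * k)"
        using fact_Suc[of "m + 2 * k", where ?'a = real] by (simp del: fact_Suc add: algebra_simps)
      ultimately show ?thesis by (simp only: times_divide_eq_right) simp
    qed
    finally show ?thesis .
  qed
  moreover have "poly_integral (monom 1 m * jacobi_poly m k * jacobi_poly m j) = 0" if "k < j"
    using jacobi_orthogonal_less[OF that] by (simp add: mult_ac)
  ultimately show ?thesis using jacobi_orthogonal_less[of j k m] by (auto simp: neq_iff)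
qed

text \<open>The hypergeometric differential equation, read off coefficientwise.\<close>

lemma jacobi_coeff_recurrence:
  "jacobi_coeff m k (Suc s) * (real (Suc s) * real (m + Suc s))
    = jacobi_coeff m k s * (real s * (real s + real m + 1) - real k * (real k + real m + 1))"
proof (cases "s \<le> k")
  case True
  have 1: "real (k choose Suc s) * real (Suc s) = (real k - real s) * real (k choose s)"
  proof -
    have "(k choose Suc s) * Suc s = (k - s) * (k choose s)"
      using binomial_absorption[of s k] binomial_absorb_comp[of k s] by (simp add: mult.commute)
    then have "real ((k choose Suc s) * Suc s) = real ((k - s) * (k choose s))" by (rule arg_cong)
    then show ?thesis using True by (simp only: of_nat_mult of_nat_diff)
  qed
  have 2: "real ((m + k + Suc s) choose k) * real (m + Suc s) = real (m + k + s + 1) * real ((m + k + s) choose k)"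
  proof -
    have "(Suc (m + k + s) choose k) * (Suc (m + k + s) - k) = Suc (m + k + s) * ((m + k + s) choose k)"
      using binomial_absorb_comp[of "Suc (m + k + s)" k] by (simp add: mult.commute)
    moreover have "Suc (m + k + s) - k = m + Suc s" by simp
    ultimately have "real ((m + k + Suc s choose k) * (m + Suc s)) = real (Suc (m + k + s) * ((m + k + s) choose k))"
      by (simp only: add_Suc_right)
    then show ?thesis by (simp only: of_nat_mult) simp
  qed
  have "jacobi_coeff m k (Suc s) * (real (Suc s) * real (m + Suc s))
      = - ((-1) ^ (k + s)) * (real (k choose Suc s) * real (Suc s)) * (real ((m + k + Suc s) choose k) * real (m + Suc s))"
    by (simp add: jacobi_coeff_def)
  also have "\<dots> = jacobi_coeff m k s * (real s * (real s + real m + 1) - real k * (real k + real m + 1))"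
    unfolding 1 2 by (simp add: jacobi_coeff_def algebra_simps)
  finally show ?thesis .
qed (simp add: jacobi_coeff_def binomial_eq_0)

text \<open>A triangle inequality over the coefficients. It loses the sharp bound 1 for the functions
\<open>(cos r)^m P\<^sub>k\<close>, but the loss is harmless against a factor \<open>exp (- 4 k (k + m) t)\<close>.\<close>

lemma jacobi_poly_bound:
  assumes "0 \<le> u" "u \<le> 1"
  shows "\<bar>poly (jacobi_poly m k) u\<bar> \<le> 2 ^ k * real ((m + 2 * k) choose k)"
proof -
  have "\<bar>poly (jacobi_poly m k) u\<bar> = \<bar>\<Sum>s\<le>k. jacobi_coeff m k s * u ^ s\<bar>"
    by (simp add: jacobi_poly_def poly_sum poly_monom)
  also have "\<dots> \<le> (\<Sum>s\<le>k. \<bar>jacobi_coeff m k s * u ^ s\<bar>)" by (rule sum_abs)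
  also have "\<dots> \<le> (\<Sum>s\<le>k. real (k choose s) * real ((m + 2 * k) choose k))"
  proof (rule sum_mono)
    fix s assume s: "s \<in> {..k}"
    have "\<bar>jacobi_coeff m k s * u ^ s\<bar> = real (k choose s) * real ((m + k + s) choose k) * u ^ s"
      using assms by (simp add: jacobi_coeff_def abs_mult)
    also have "\<dots> \<le> real (k choose s) * real ((m + 2 * k) choose k) * 1"
      using s assms by (intro mult_mono mult_left_mono) (auto intro!: binomial_mono power_le_one simp: binomial_right_mono)
    finally show "\<bar>jacobi_coeff m k s * u ^ s\<bar> \<le> real (k choose s) * real ((m + 2 * k) choose k)" by simp
  qed
  also have "\<dots> = real (\<Sum>s\<le>k. k choose s) * real ((m + 2 * k) choose k)"
    by (simp add: sum_distrib_right)
  finally show ?thesis by (simp add: choose_row_sum)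
qed

text \<open>Under \<open>y = 2u - 1\<close> the function in Rodrigues' formula becomes \<open>2^m 4^k u^(m+k) (1 - u)^k\<close>, and \<open>k\<close>
applications of the chain rule give a factor \<open>2^k\<close>.\<close>

lemma jacobi0_eq_jacobi_poly:
  assumes "u \<noteq> 0"
  shows "jacobi0 m k (2 * u - 1) = poly (jacobi_poly m k) u"
proof -
  define H :: "real poly" where "H = [:1, 1:] ^ m * ([:1, -1:] * [:1, 1:]) ^ k"
  have "(\<lambda>y. (1 + y) ^ m * (1 - y\<^sup>2) ^ k) = poly H"
  proof
    fix y :: real
    have "1 - y\<^sup>2 = (1 - y) * (1 + y)" by (simp add: power2_eq_square algebra_simps)
    then show "(1 + y) ^ m * (1 - y\<^sup>2) ^ k = poly H y"
      unfolding H_def poly_mult poly_power by simp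
  qed
  moreover have "(deriv ^^ k) (poly H) = poly ((pderiv ^^ k) H)" for k and H :: "real poly"
  proof (induction k)
    case (Suc k)
    have "deriv (poly p) = poly (pderiv p)" for p :: "real poly"
      by (auto intro!: DERIV_imp_deriv)
    then show ?case by (simp add: Suc)
  qed simp
  ultimately have d: "(deriv ^^ k) (\<lambda>y. (1 + y) ^ m * (1 - y\<^sup>2) ^ k) = poly ((pderiv ^^ k) H)"
    by simp
  let ?l = "[:-1, 2:] :: real poly"
  have chain: "(pderiv ^^ k) (pcompose H ?l) = smult (2 ^ k) (pcompose ((pderiv ^^ k) H) ?l)"
    for k and H :: "real poly"
    by (induction k) (auto simp: pderiv_pcompose pderiv_smult pderiv_pCons mult.commute)
  have "pcompose H ?l = smult (2 ^ m * 4 ^ k) (rodrigues_poly m k)"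
  proof -
    have "poly (pcompose H ?l) x = poly (smult (2 ^ m * 4 ^ k) (rodrigues_poly m k)) x" for x
    proof -
      have "poly (pcompose H ?l) x = (x * 2) ^ m * ((2 - x * 2) * (x * 2)) ^ k"
        unfolding H_def poly_pcompose poly_mult poly_power by simp
      also have "(2 - x * 2) * (x * 2) = 4 * (x * (1 - x))" by (simp add: algebra_simps)
      finally show ?thesis
        by (simp add: rodrigues_poly_def power_add power_mult_distrib)
    qed
    then show ?thesis by (intro poly_eq_poly_eq_iff[THEN iffD1] ext)
  qed
  then have "smult (2 ^ k) (pcompose ((pderiv ^^ k) H) ?l)
      = smult (2 ^ m * 4 ^ k * ((-1) ^ k * fact k)) (monom 1 m * jacobi_poly m k)"
    using chain[of k H] by (simp add: higher_pderiv_smult higher_pderiv_rodrigues)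
  from arg_cong[OF this, of "\<lambda>p. poly p u"]
  have "2 ^ k * poly ((pderiv ^^ k) H) (2 * u - 1)
      = 2 ^ m * 4 ^ k * ((-1) ^ k * fact k) * (u ^ m * poly (jacobi_poly m k) u)"
    by (simp add: poly_pcompose poly_monom mult.commute)
  then have ph: "poly ((pderiv ^^ k) H) (2 * u - 1)
      = 2 ^ m * 2 ^ k * ((-1) ^ k * fact k) * (u ^ m * poly (jacobi_poly m k) u)"
  proof -
    have "(4::real) ^ k = 2 ^ k * 2 ^ k" by (simp add: power_mult_distrib[symmetric])
    then show ?thesis using \<open>2 ^ k * _ = _\<close> by simp
  qed
  then show ?thesis
  proof -
    have x: "1 + (2 * u - 1) = 2 * u" by simp
    have s: "(-1 :: real) ^ k * (-1) ^ k = 1" by (simp add: power_mult_distrib[symmetric])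
    have cancel: "A / (B * F * (M * U)) * (M * B * (A * F) * (U * J)) = J"
      if "A * A = 1" "B \<noteq> 0" "F \<noteq> 0" "M \<noteq> 0" "U \<noteq> 0" for A B F M U J :: real
    proof -
      have "A / (B * F * (M * U)) * (M * B * (A * F) * (U * J)) = A * A * J"
        using that(2-5) by simp
      then show ?thesis using that(1) by simp
    qed
    show ?thesis
      unfolding jacobi0_def d x ph power_mult_distrib[of 2 u m]
      by (rule cancel) (use s assms in auto)
  qed
qed

section \<open>The heat semigroup on polynomial functions\<close>

text \<open>Completeness is what the uniform boundedness principle and absolutely convergent series in this
space rely on.\<close>

instance bcontfun :: (metric_space, banach) banach ..

lemma compact_UNIV_su2: "compact (UNIV :: su2 set)"
proof -
  have "continuous_on SU2 Abs_su2"
    unfolding continuous_on_iff by (auto simp: dist_su2_def Abs_su2_inverse)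
  then have "compact (Abs_su2 ` SU2)" using compact_SU2 by (rule compact_continuous_image)
  moreover have "Abs_su2 ` SU2 = UNIV" by (metis Abs_su2_cases UNIV_eq_I imageI)
  ultimately show ?thesis by simp
qed

lemma continuous_bcontfun_su2:
  fixes f :: "su2 \<Rightarrow> real"
  assumes "continuous_on UNIV f" shows "f \<in> bcontfun"
  using assms compact_imp_bounded[OF compact_continuous_image[OF assms compact_UNIV_su2]]
  by (simp add: bcontfun_def)

lemma apply_Bcontfun_su2:
  fixes f :: "su2 \<Rightarrow> real"
  assumes "continuous_on UNIV f" shows "apply_bcontfun (Bcontfun f) = f"
  by (rule Bcontfun_inverse) (rule continuous_bcontfun_su2[OF assms])

lemma su2_one_coords: "ca su2_one = 1" "cb su2_one = 0"
  by (simp_all add: ca_def cb_def su2_one_def Abs_su2_inverse mat_1_in_SU2 mat2_one_nth)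

definition re_monomial :: "complex \<Rightarrow> nat \<Rightarrow> nat \<Rightarrow> nat \<Rightarrow> su2 \<Rightarrow>\<^sub>C real" where
  "re_monomial w i j k = Bcontfun (\<lambda>g. Re (monomial w i j k g))"

lemma apply_re_monomial: "apply_bcontfun (re_monomial w i j k) = (\<lambda>g. Re (monomial w i j k g))"
  unfolding re_monomial_def
  by (rule apply_Bcontfun_su2) (intro continuous_intros continuous_on_monomial)

text \<open>The formula for \<open>L\<close> on monomials, read in the Banach space of continuous functions: smooth functions
lie in the domain of the generator.\<close>

lemma re_monomial_generator:
  assumes "is_heat_semigroup P"
  shows "(re_monomial w i j k, (4 * real i * real j) *\<^sub>R re_monomial w (i - 1) (j - 1) k
      - (4 * real i * real j + 4 * real i * real k + 2 * (real i + real j + real k)) *\<^sub>R re_monomial w i j k)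
    \<in> generator P" (is "(?f, ?g) \<in> _")
proof -
  have "(?f, ?g) \<in> sub_laplacian_graph"
    by (simp add: sub_laplacian_graph_def apply_re_monomial su2_smooth_monomial sub_laplacian_monomial fun_eq_iff)
  then show ?thesis
    using assms closure_subset by (auto simp: is_heat_semigroup_def)
qed

lemma bounded_linear_apply_bcontfun: "bounded_linear (\<lambda>f :: su2 \<Rightarrow>\<^sub>C real. apply_bcontfun f x)"
proof (rule bounded_linear_intro[of _ 1])
  fix f :: "su2 \<Rightarrow>\<^sub>C real"
  show "norm (apply_bcontfun f x) \<le> norm f * 1" using norm_bounded[of f x] by simp
qed auto

text \<open>The function vanishes at the identity, where \<open>b = 0\<close>, and up to a multiple of itself \<open>L\<close> maps it to
a monomial with smaller \<open>i\<close> and the same \<open>k\<close>. So the error term in the eigenvector lemma is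
covered by induction; for \<open>i = 0\<close> it is zero.\<close>

lemma heat_re_monomial_at_one:
  assumes P: "is_heat_semigroup P" and k: "k > 0" and t: "t \<ge> 0"
  shows "apply_bcontfun (P t (re_monomial w i j k)) su2_one = 0"
  using t
proof (induction i arbitrary: j t)
  have C0: "C0_semigroup P" using P by (simp add: is_heat_semigroup_def)
  have one: "apply_bcontfun (re_monomial w i j k) su2_one = 0" for i j
    using k by (simp add: apply_re_monomial monomial_def su2_one_coords)
  have step: "apply_bcontfun (P t (re_monomial w i j k)) su2_one = 0"
    if "t \<ge> 0" "\<And>t. t \<ge> 0 \<Longrightarrow> apply_bcontfun (P t ((4 * real i * real j) *\<^sub>R re_monomial w (i - 1) (j - 1) k)) su2_one = 0"
    for i j t
  proof -
    let ?l = "4 * real i * real j + 4 * real i * real k + 2 * (real i + real j + real k)"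
    have "(re_monomial w i j k, (- ?l) *\<^sub>R re_monomial w i j k
        + (4 * real i * real j) *\<^sub>R re_monomial w (i - 1) (j - 1) k) \<in> generator P"
      using re_monomial_generator[OF P, of w i j k]
      unfolding scaleR_minus_left by (simp only: uminus_add_conv_diff)
    from C0_semigroup_eigenvector[OF C0 this bounded_linear_apply_bcontfun[of su2_one], OF that(2) that(1)]
    show ?thesis using one[of i j] by simp
  qed
  {
    case 0
    show ?case by (rule step) (use 0 in \<open>auto simp: blinfun.zero_right\<close>)
  next
    case (Suc i)
    show ?case
      by (rule step) (use Suc in \<open>auto simp: blinfun.scaleR_right\<close>)
  }
qed

text \<open>The real part of \<open>w a^m P\<^sub>k(2\<bar>a\<bar>\<^sup>2 - 1)\<close>, written through monomials because \<open>L\<close> is known on those.\<close>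

definition harmonic :: "complex \<Rightarrow> nat \<Rightarrow> nat \<Rightarrow> su2 \<Rightarrow>\<^sub>C real" where
  "harmonic w m k = (\<Sum>s\<le>k. jacobi_coeff m k s *\<^sub>R re_monomial w (m + s) s 0)"

definition heat_eigenvalue :: "nat \<Rightarrow> nat \<Rightarrow> real" where
  "heat_eigenvalue m k = 4 * real k * (real k + real m + 1) + 2 * real m"

lemma apply_bcontfun_sum: "apply_bcontfun (sum f I) x = (\<Sum>i\<in>I. apply_bcontfun (f i) x)"
  for f :: "'i \<Rightarrow> 'a::topological_space \<Rightarrow>\<^sub>C 'b::real_normed_vector"
  by (induction I rule: infinite_finite_induct) auto

lemma apply_harmonic:
  "apply_bcontfun (harmonic w m k) g = Re (w * ca g ^ m) * poly (jacobi_poly m k) ((cmod (ca g))\<^sup>2)"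
proof -
  have "Re (monomial w (m + s) s 0 g) = Re (w * ca g ^ m) * ((cmod (ca g))\<^sup>2) ^ s" for s
  proof -
    have "monomial w (m + s) s 0 g = w * ca g ^ m * (ca g * cnj (ca g)) ^ s"
      by (simp add: monomial_def power_add power_mult_distrib)
    also have "(ca g * cnj (ca g)) ^ s = of_real (((cmod (ca g))\<^sup>2) ^ s)"
      by (simp only: complex_norm_square[symmetric] of_real_power)
    finally show ?thesis by (simp del: of_real_power)
  qed
  then show ?thesis
    by (simp add: harmonic_def apply_bcontfun_sum apply_re_monomial jacobi_poly_def poly_sum poly_monom
        sum_distrib_left mult_ac)
qed

text \<open>\<open>L\<close> lowers the exponents of \<open>a\<close> and \<open>cnj(a)\<close> together, so its off-diagonal part shifts the index
\<open>s\<close> by one; by the coefficient recurrence, the shifted sum combines with the diagonal one to a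
multiple of the original.\<close>

lemma harmonic_generator:
  assumes P: "is_heat_semigroup P"
  shows "(harmonic w m k, (- heat_eigenvalue m k) *\<^sub>R harmonic w m k) \<in> generator P"
proof -
  let ?f = "\<lambda>s. re_monomial w (m + s) s 0" and ?c = "jacobi_coeff m k"
  let ?g = "\<lambda>s. ?c s *\<^sub>R ((4 * real (m + s) * real s) *\<^sub>R re_monomial w (m + s - 1) (s - 1) 0
      - (4 * real (m + s) * real s + 2 * (real (m + s) + real s)) *\<^sub>R ?f s)"
  have "(harmonic w m k, \<Sum>s\<le>k. ?g s) \<in> generator P"
    unfolding harmonic_def
  proof (intro generator_sum generator_scaleR)
    fix s
    show "(?f s, (4 * real (m + s) * real s) *\<^sub>R re_monomial w (m + s - 1) (s - 1) 0
        - (4 * real (m + s) * real s + 2 * (real (m + s) + real s)) *\<^sub>R ?f s) \<in> generator P"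
      using re_monomial_generator[OF P, of w "m + s" s 0] by simp
  qed
  moreover have "(\<Sum>s\<le>k. ?g s) = (- heat_eigenvalue m k) *\<^sub>R harmonic w m k"
  proof -
    have "(\<Sum>s\<le>k. (?c s * (4 * real (m + s) * real s)) *\<^sub>R re_monomial w (m + s - 1) (s - 1) 0)
        = (\<Sum>s<k. (?c (Suc s) * (4 * real (m + Suc s) * real (Suc s))) *\<^sub>R ?f s)"
      by (subst sum.atMost_shift) simp
    also have "\<dots> = (\<Sum>s<k. (4 * (?c s * (real s * (real s + real m + 1) - real k * (real k + real m + 1)))) *\<^sub>R ?f s)"
    proof (intro sum.cong refl arg_cong2[where f = scaleR])
      fix s
      have "?c (Suc s) * (4 * real (m + Suc s) * real (Suc s)) = 4 * (?c (Suc s) * (real (Suc s) * real (m + Suc s)))"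
        by (simp only: mult_ac)
      then show "?c (Suc s) * (4 * real (m + Suc s) * real (Suc s))
          = 4 * (?c s * (real s * (real s + real m + 1) - real k * (real k + real m + 1)))"
        by (simp only: jacobi_coeff_recurrence)
    qed
    also have "\<dots> = (\<Sum>s\<le>k. (4 * (?c s * (real s * (real s + real m + 1) - real k * (real k + real m + 1)))) *\<^sub>R ?f s)"
      by (simp add: lessThan_Suc_atMost[symmetric])
    finally have "(\<Sum>s\<le>k. ?g s) = (\<Sum>s\<le>k. (4 * (?c s * (real s * (real s + real m + 1) - real k * (real k + real m + 1)))
        - ?c s * (4 * real (m + s) * real s + 2 * (real (m + s) + real s))) *\<^sub>R ?f s)"
      by (simp add: scaleR_diff_right scaleR_diff_left sum_subtractf)
    also have "\<dots> = (\<Sum>s\<le>k. (- heat_eigenvalue m k) *\<^sub>R ?c s *\<^sub>R ?f s)"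
      unfolding scaleR_scaleR
      by (intro sum.cong refl arg_cong2[where f = scaleR]) (simp add: heat_eigenvalue_def algebra_simps)
    finally show ?thesis by (simp only: harmonic_def scaleR_sum_right)
  qed
  ultimately show ?thesis by simp
qed

lemma heat_harmonic_at_one:
  assumes P: "is_heat_semigroup P" and t: "t \<ge> 0"
  shows "apply_bcontfun (P t (harmonic w m k)) su2_one = exp (- heat_eigenvalue m k * t) * Re w"
proof -
  have C0: "C0_semigroup P" using P by (simp add: is_heat_semigroup_def)
  have "(harmonic w m k, (- heat_eigenvalue m k) *\<^sub>R harmonic w m k + 0) \<in> generator P"
    using harmonic_generator[OF P] by simp
  from C0_semigroup_eigenvector[OF C0 this bounded_linear_apply_bcontfun[of su2_one], OF _ t]
  have "apply_bcontfun (P t (harmonic w m k)) su2_one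
      = exp (- heat_eigenvalue m k * t) * apply_bcontfun (harmonic w m k) su2_one"
    by (simp add: blinfun.zero_right)
  then show ?thesis by (simp add: apply_harmonic su2_one_coords jacobi_poly_1)
qed

section \<open>Haar measure in cylindric coordinates\<close>

lemma continuous_on_su2I:
  fixes h :: "'a::metric_space \<Rightarrow> su2"
  assumes "continuous_on S (\<lambda>x. ca (h x))" "continuous_on S (\<lambda>x. cb (h x))"
  shows "continuous_on S h"
proof -
  have R: "Rep_su2 g $ 2 $ 1 = - cnj (cb g)" "Rep_su2 g $ 2 $ 2 = cnj (ca g)"
      "Rep_su2 g $ 1 $ 1 = ca g" "Rep_su2 g $ 1 $ 2 = cb g" for g
    using Rep_su2[of g] by (auto simp: SU2_iff ca_def cb_def)
  have c: "continuous_on S (\<lambda>x. Rep_su2 (h x) $ i $ j)" for i j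
    using exhaust_2[of i] exhaust_2[of j] assms by (auto simp: R intro!: continuous_on_minus continuous_on_cnj)
  have "continuous_on S (\<lambda>x. \<chi> i. \<chi> j. Rep_su2 (h x) $ i $ j)"
    by (intro continuous_on_vec_lambda c)
  then have "continuous_on S (\<lambda>x. Rep_su2 (h x))" by simp
  then show ?thesis by (simp add: continuous_on_iff dist_su2_def)
qed

lemma cylindric_coords:
  shows ca_cylindric: "ca (cylindric r \<theta> z) = of_real (cos r) * cis z"
    and cb_cylindric: "cb (cylindric r \<theta> z) = of_real (sin r) * cis (\<theta> - z)"
proof -
  let ?a = "complex_of_real (cos r) * cis z" and ?b = "complex_of_real (sin r) * cis (\<theta> - z)"
  have u: "cis x * cnj (cis x) = 1" for x by (simp add: cis_cnj cis_mult)
  have "?a * cnj ?a + ?b * cnj ?b = of_real (cos r * cos r) * (cis z * cnj (cis z))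
      + of_real (sin r * sin r) * (cis (\<theta> - z) * cnj (cis (\<theta> - z)))"
    by simp
  also have "\<dots> = of_real (cos r * cos r + sin r * sin r)" unfolding u by (simp only: mult_1_right of_real_add)
  also have "\<dots> = 1" using sin_cos_squared_add[of r] by (simp add: power2_eq_square add.commute)
  finally have n: "?a * cnj ?a + ?b * cnj ?b = 1" .
  have "cylindric r \<theta> z = su2_of ?a ?b"
    by (simp add: cylindric_def su2_of_def cis_cnj)
  with n show "ca (cylindric r \<theta> z) = ?a" "cb (cylindric r \<theta> z) = ?b"
    by (simp_all add: ca_su2_of cb_su2_of)
qed

lemma continuous_on_cylindric: "continuous_on S (\<lambda>(r, \<theta>, z). cylindric r \<theta> z)"
  unfolding case_prod_unfold
  by (rule continuous_on_su2I) (simp_all add: cylindric_coords, (intro continuous_intros)+)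

text \<open>The closed coordinate box, so that integrals of continuous functions over it are iterated
integrals.\<close>

abbreviation cyl_box :: "(real \<times> real \<times> real) set" where
  "cyl_box \<equiv> cbox (0, 0, -pi) (pi/2, 2*pi, pi)"

lemma cyl_box_eq: "cyl_box = {0..pi/2} \<times> {0..2*pi} \<times> {-pi..pi}"
  by (simp add: cbox_Pair_eq)

text \<open>The half-open range of \<open>r\<close> may be closed without changing the integrand, because the density
\<open>sin 2r\<close> vanishes at \<open>r = \<pi>/2\<close>.\<close>

lemma haar_integral:
  fixes f :: "su2 \<Rightarrow> real"
  assumes f: "continuous_on UNIV f"
  shows "(LINT g|su2_haar. f g)
    = (1 / (4 * pi\<^sup>2)) * integral cyl_box (\<lambda>(r, \<theta>, z). sin (2 * r) * f (cylindric r \<theta> z))"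
proof -
  define D :: "real \<times> real \<times> real \<Rightarrow> real" where
    "D = (\<lambda>(r, \<theta>, z). indicator ({0..<pi/2} \<times> {0..2*pi} \<times> {-pi..pi}) (r, \<theta>, z) * (1 / (4 * pi\<^sup>2)) * sin (2 * r))"
  define C where "C = (\<lambda>(r, \<theta>, z). cylindric r \<theta> z)"
  define F where "F = (\<lambda>(r, \<theta>, z). sin (2 * r) * f (cylindric r \<theta> z))"
  have C: "C \<in> borel_measurable borel"
    unfolding C_def by (intro borel_measurable_continuous_onI continuous_on_cylindric)
  have fm: "f \<in> borel_measurable borel"
    by (intro borel_measurable_continuous_onI f)
  have Fc: "continuous_on S F" for S
  proof -
    have "continuous_on S (\<lambda>x. f (C x))"
      unfolding C_def by (rule continuous_on_compose2[OF f continuous_on_cylindric]) auto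
    then have "continuous_on S (\<lambda>x. sin (2 * fst x) * f (C x))" by (intro continuous_intros)
    then show ?thesis by (simp add: F_def C_def case_prod_unfold)
  qed
  have Dm: "D \<in> borel_measurable borel"
  proof -
    have "D = (\<lambda>x. indicator ({0..<pi/2} \<times> {0..2*pi} \<times> {-pi..pi}) x * (1 / (4 * pi\<^sup>2)) * sin (2 * fst x))"
      by (auto simp: D_def)
    moreover have "{0..<pi/2} \<times> {0..2*pi} \<times> {-pi..pi} \<in> sets (borel :: (real \<times> real \<times> real) measure)"
      by (simp only: borel_prod[symmetric]) (intro pair_measureI, auto)
    moreover have "(\<lambda>x :: real \<times> real \<times> real. sin (2 * fst x)) \<in> borel_measurable borel"
      by (intro borel_measurable_continuous_onI continuous_intros)
    ultimately show ?thesis by (auto intro!: borel_measurable_times borel_measurable_indicator)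
  qed
  have D0: "0 \<le> D x" for x
    by (cases x) (auto simp: D_def indicator_def intro!: mult_nonneg_nonneg divide_nonneg_nonneg sin_ge_zero)
  have haar: "su2_haar = distr (density lborel (\<lambda>x. ennreal (D x))) borel C"
    unfolding su2_haar_def C_def D_def by (simp add: case_prod_unfold)
  have "(LINT g|su2_haar. f g) = (LINT x|lborel. D x *\<^sub>R f (C x))"
    unfolding haar
  proof (subst integral_distr)
    show "(LINT x|density lborel (\<lambda>x. ennreal (D x)). f (C x)) = (LINT x|lborel. D x *\<^sub>R f (C x))"
      by (rule integral_density) (use C fm Dm D0 in auto)
  qed (use C fm in \<open>simp_all\<close>)
  also have "\<dots> = (LINT x|lborel. (1 / (4 * pi\<^sup>2)) * (indicator cyl_box x *\<^sub>R F x))"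
  proof (rule Bochner_Integration.integral_cong)
    fix x :: "real \<times> real \<times> real"
    obtain r \<theta> z where x: "x = (r, \<theta>, z)" by (cases x)
    show "D x *\<^sub>R f (C x) = (1 / (4 * pi\<^sup>2)) * (indicator cyl_box x *\<^sub>R F x)"
    proof (cases "r = pi/2")
      case True
      have "sin (2 * r) = 0" unfolding True by simp
      then show ?thesis by (simp add: x D_def F_def C_def)
    next
      case False
      then have "(r, \<theta>, z) \<in> cyl_box \<longleftrightarrow> (r, \<theta>, z) \<in> {0..<pi/2} \<times> {0..2*pi} \<times> {-pi..pi}"
        unfolding cyl_box_eq by auto
      then show ?thesis by (simp add: x D_def F_def C_def indicator_def)
    qed
  qed simp
  also have "\<dots> = (1 / (4 * pi\<^sup>2)) * (LINT x:cyl_box|lborel. F x)"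
    by (simp add: set_lebesgue_integral_def)
  also have "(LINT x:cyl_box|lborel. F x) = integral cyl_box F"
    by (rule set_borel_integral_eq_integral)
       (unfold set_integrable_def, rule borel_integrable_compact[OF compact_cbox Fc])
  finally show ?thesis by (simp add: F_def)
qed

text \<open>Two product terms are allowed since an angular factor \<open>Re (w cis (k \<theta> + c z))\<close> splits, by the addition
formula, into a sum of two products.\<close>

lemma haar_integral_product:
  fixes f :: "su2 \<Rightarrow> real"
  assumes f: "continuous_on UNIV f" and RSZ: "continuous_on UNIV R" "continuous_on UNIV S" "continuous_on UNIV Z"
    "continuous_on UNIV S'" "continuous_on UNIV Z'"
    and eq: "\<And>r \<theta> z. f (cylindric r \<theta> z) = R r * (S \<theta> * Z z + S' \<theta> * Z' z)"
  shows "(LINT g|su2_haar. f g) = (1 / (4 * pi\<^sup>2)) * (integral {0..pi/2} (\<lambda>r. sin (2 * r) * R r) *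
     (integral {0..2*pi} S * integral {-pi..pi} Z + integral {0..2*pi} S' * integral {-pi..pi} Z'))"
proof -
  note co = continuous_on_compose2[OF RSZ(1) _ subset_UNIV] continuous_on_compose2[OF RSZ(2) _ subset_UNIV]
    continuous_on_compose2[OF RSZ(3) _ subset_UNIV] continuous_on_compose2[OF RSZ(4) _ subset_UNIV]
    continuous_on_compose2[OF RSZ(5) _ subset_UNIV]
  note ii = integrable_continuous_interval[OF continuous_on_subset[OF _ subset_UNIV]]
  have "integral cyl_box (\<lambda>(r, \<theta>, z). sin (2 * r) * f (cylindric r \<theta> z))
      = integral cyl_box (\<lambda>(r, \<theta>, z). sin (2 * r) * R r * (S \<theta> * Z z + S' \<theta> * Z' z))"
    by (simp add: eq mult.assoc)
  also have "\<dots> = integral {0..pi/2} (\<lambda>r. integral (cbox (0, -pi) (2*pi, pi))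
      (\<lambda>(\<theta>, z). sin (2 * r) * R r * (S \<theta> * Z z + S' \<theta> * Z' z)))"
    by (subst integral_prod_continuous) (auto simp: case_prod_unfold intro!: continuous_intros co)
  also have "(\<lambda>r. integral (cbox (0, -pi) (2*pi, pi)) (\<lambda>(\<theta>, z). sin (2 * r) * R r * (S \<theta> * Z z + S' \<theta> * Z' z)))
      = (\<lambda>r. (sin (2 * r) * R r) * (integral {0..2*pi} S * integral {-pi..pi} Z + integral {0..2*pi} S' * integral {-pi..pi} Z'))"
  proof
    fix r
    have "integral (cbox (0, -pi) (2*pi, pi)) (\<lambda>(\<theta>, z). sin (2 * r) * R r * (S \<theta> * Z z + S' \<theta> * Z' z))
       = integral {0..2*pi} (\<lambda>\<theta>. integral {-pi..pi} (\<lambda>z. sin (2 * r) * R r * (S \<theta> * Z z + S' \<theta> * Z' z)))"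
      by (subst integral_prod_continuous) (auto simp: case_prod_unfold intro!: continuous_intros co)
    also have "(\<lambda>\<theta>. integral {-pi..pi} (\<lambda>z. sin (2 * r) * R r * (S \<theta> * Z z + S' \<theta> * Z' z)))
       = (\<lambda>\<theta>. sin (2 * r) * R r * (S \<theta> * integral {-pi..pi} Z + S' \<theta> * integral {-pi..pi} Z'))"
      by (subst integral_mult_right, subst integral_add)
         (auto simp: integral_mult_right intro!: ii continuous_intros RSZ)
    also have "integral {0..2*pi} \<dots> = sin (2 * r) * R r * (integral {0..2*pi} S * integral {-pi..pi} Z + integral {0..2*pi} S' * integral {-pi..pi} Z')"
      by (subst integral_mult_right, subst integral_add)
         (auto simp: integral_mult_left intro!: ii continuous_intros RSZ)
    finally show "integral (cbox (0, -pi) (2*pi, pi)) (\<lambda>(\<theta>, z). sin (2 * r) * R r * (S \<theta> * Z z + S' \<theta> * Z' z))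
      = (sin (2 * r) * R r) * (integral {0..2*pi} S * integral {-pi..pi} Z + integral {0..2*pi} S' * integral {-pi..pi} Z')" .
  qed
  finally show ?thesis unfolding haar_integral[OF f] by (simp add: integral_mult_left)
qed

text \<open>Inside the box the density is positive, so a continuous nonnegative integrand with integral 0
vanishes there; the face \<open>r = 0\<close>, where the density is 0, is reached by continuity.\<close>

lemma haar_faithful:
  fixes f :: "su2 \<Rightarrow> real"
  assumes f: "continuous_on UNIV f" "\<And>g. f g \<ge> 0" and 0: "(LINT g|su2_haar. f g) = 0"
    and r: "0 \<le> r" "r < pi/2" and t: "\<theta> \<in> {0..2*pi}" "z \<in> {-pi..pi}"
  shows "f (cylindric r \<theta> z) = 0"
proof -
  define F where "F = (\<lambda>(r, \<theta>, z). sin (2 * r) * f (cylindric r \<theta> z))"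
  have fc: "continuous_on S (\<lambda>x. f ((\<lambda>(r, \<theta>, z). cylindric r \<theta> z) x))" for S
    by (rule continuous_on_compose2[OF f(1) continuous_on_cylindric]) auto
  have Fc: "continuous_on cyl_box F"
  proof -
    have "continuous_on cyl_box (\<lambda>x. sin (2 * fst x) * f ((\<lambda>(r, \<theta>, z). cylindric r \<theta> z) x))"
      by (intro continuous_intros fc)
    then show ?thesis by (simp add: F_def case_prod_unfold)
  qed
  have I0: "integral cyl_box F = 0" using 0 by (simp add: haar_integral[OF f(1)] F_def)
  have pos: "0 \<le> F x" if "x \<in> cyl_box" for x
    using that f(2) unfolding cyl_box_eq by (auto simp: F_def intro!: mult_nonneg_nonneg sin_ge_zero)
  have int0: "(F has_integral 0) cyl_box"
    using integrable_integral[OF integrable_continuous[OF Fc]] I0 by simp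
  have F0: "F x = 0" if "x \<in> cyl_box" for x
  proof (rule has_integral_0_cbox_imp_0[OF Fc _ _ _ that])
    show "box (0, 0, - pi) (pi / 2, 2 * pi, pi) \<noteq> {}" by (auto simp: box_ne_empty Basis_prod_def)
  qed (use pos box_subset_cbox int0 in blast)+
  have inner: "f (cylindric s \<theta> z) = 0" if "s \<in> {0<..<pi/2}" for s
  proof -
    have "F (s, \<theta>, z) = 0" using that t by (intro F0) (auto simp: cyl_box_eq)
    moreover have "sin (2 * s) > 0" using that by (intro sin_gt_zero) auto
    ultimately show ?thesis by (simp add: F_def)
  qed
  have c: "continuous_on A (\<lambda>s. (s, \<theta>, z))" for A :: "real set" by (intro continuous_intros)
  have "continuous_on (closure {0<..<pi/2}) (\<lambda>s. f (cylindric s \<theta> z))"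
    using continuous_on_compose2[OF fc[of UNIV], of _ "\<lambda>s. (s, \<theta>, z)", OF c] by simp
  then show ?thesis
    by (rule continuous_constant_on_closure[OF _ inner]) (use r in auto)
qed

section \<open>Haar inner products of the eigenfunctions\<close>

lemma integral_cos_mult:
  assumes "c \<noteq> 0" "a \<le> b"
  shows "integral {a..b} (\<lambda>x::real. cos (c * x)) = (sin (c * b) - sin (c * a)) / c"
proof -
  have "((\<lambda>x. cos (c * x)) has_integral sin (c * b) / c - sin (c * a) / c) {a..b}"
    using assms by (intro fundamental_theorem_of_calculus)
      (auto simp: has_real_derivative_iff_has_vector_derivative[symmetric] intro!: derivative_eq_intros)
  then show ?thesis by (simp add: integral_unique diff_divide_distrib)
qed

lemma integral_sin_mult:
  assumes "c \<noteq> 0" "a \<le> b"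
  shows "integral {a..b} (\<lambda>x::real. sin (c * x)) = (cos (c * a) - cos (c * b)) / c"
proof -
  have "((\<lambda>x. sin (c * x)) has_integral (- cos (c * b) / c) - (- cos (c * a) / c)) {a..b}"
    using assms by (intro fundamental_theorem_of_calculus)
      (auto simp: has_real_derivative_iff_has_vector_derivative[symmetric] intro!: derivative_eq_intros)
  then show ?thesis by (simp add: integral_unique diff_divide_distrib)
qed

lemma integral_cos_period:
  "integral {-pi..pi} (\<lambda>x. cos (of_int l * x)) = (if l = 0 then 2 * pi else 0)"
proof (cases "l = 0")
  case False
  then show ?thesis by (simp add: integral_cos_mult) (simp add: sin_zero_iff_int2)
qed simp

lemma integral_sin_period: "integral {-pi..pi} (\<lambda>x. sin (of_int l * x)) = 0"
  by (cases "l = 0") (simp_all add: integral_sin_mult)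

lemma integral_cos_cis:
  "integral {-pi..pi} (\<lambda>z. cos (real n * z) * Re (w * cis (real m * z)))
    = (if n = m then (if m = 0 then 2 * pi else pi) * Re w else 0)"
proof -
  have "cos (real n * z) * Re (w * cis (real m * z)) =
     Re w / 2 * cos (of_int (int n - int m) * z) + Re w / 2 * cos (of_int (int n + int m) * z)
     - (Im w / 2 * sin (of_int (int n + int m) * z) - Im w / 2 * sin (of_int (int n - int m) * z))" for z
    by (simp add: ring_distribs cos_add cos_diff sin_add sin_diff)
  then have "integral {-pi..pi} (\<lambda>z. cos (real n * z) * Re (w * cis (real m * z)))
     = integral {-pi..pi} (\<lambda>z. Re w / 2 * cos (of_int (int n - int m) * z) + Re w / 2 * cos (of_int (int n + int m) * z)
     - (Im w / 2 * sin (of_int (int n + int m) * z) - Im w / 2 * sin (of_int (int n - int m) * z)))"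
    by (simp only:)
  also have "\<dots> = (Re w / 2 * integral {-pi..pi} (\<lambda>z. cos (of_int (int n - int m) * z))
      + Re w / 2 * integral {-pi..pi} (\<lambda>z. cos (of_int (int n + int m) * z)))
     - (Im w / 2 * integral {-pi..pi} (\<lambda>z. sin (of_int (int n + int m) * z))
        - Im w / 2 * integral {-pi..pi} (\<lambda>z. sin (of_int (int n - int m) * z)))"
    by (simp only: integral_diff integral_add integral_mult_right integrable_continuous_interval
       integrable_diff integrable_add continuous_intros)
  also have "\<dots> = (if n = m then (if m = 0 then 2 * pi else pi) * Re w else 0)"
    unfolding integral_cos_period integral_sin_period by (auto simp: algebra_simps)
  finally show ?thesis .
qed

text \<open>The substitution \<open>u = cos\<^sup>2 r\<close> with \<open>du = - sin 2r dr\<close>, which absorbs the Haar density.\<close>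

lemma integral_poly_cos_squared:
  "integral {0..pi/2} (\<lambda>r. sin (2 * r) * poly p ((cos r)\<^sup>2)) = poly_integral p"
proof -
  have "((\<lambda>x. (- sin (2 * x)) *\<^sub>R poly p ((cos x)\<^sup>2)) has_integral
      (integral {(cos 0)\<^sup>2..(cos (pi/2))\<^sup>2} (poly p) - integral {(cos (pi/2))\<^sup>2..(cos 0)\<^sup>2} (poly p))) {0..pi/2}"
    by (rule has_integral_substitution_general[of "{}" 0 "pi/2" _ 0 1])
       (auto simp: power_le_one_iff abs_square_le_1 sin_double intro!: derivative_eq_intros continuous_intros)
  then have "((\<lambda>x. - (sin (2 * x) * poly p ((cos x)\<^sup>2))) has_integral - poly_integral p) {0..pi/2}"
    by (simp add: poly_integral_def)
  from has_integral_neg[OF this] show ?thesis by (simp add: integral_unique)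
qed

lemma harmonic_cylindric:
  "apply_bcontfun (harmonic w m k) (cylindric r \<theta> z)
    = cos r ^ m * poly (jacobi_poly m k) ((cos r)\<^sup>2) * Re (w * cis (real m * z))"
proof -
  have "w * (of_real (cos r) * cis z) ^ m = of_real (cos r ^ m) * (w * cis (real m * z))"
    by (simp only: power_mult_distrib Complex.DeMoivre of_real_power) (simp only: mult_ac)
  moreover have "Re (of_real x * y) = x * Re y" for x y by simp
  moreover have "(cmod (of_real (cos r) * cis z))\<^sup>2 = (cos r)\<^sup>2" by (simp add: norm_mult)
  ultimately show ?thesis by (simp only: apply_harmonic ca_cylindric) (simp only: mult_ac)
qed

lemma re_monomial_cylindric:
  "apply_bcontfun (re_monomial w i j k) (cylindric r \<theta> z)
    = cos r ^ (i + j) * sin r ^ k *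
      (cos (real k * \<theta>) * Re (w * cis ((real i - real j - real k) * z))
       + - sin (real k * \<theta>) * Im (w * cis ((real i - real j - real k) * z)))"
proof -
  have c: "cis (real i * z) * cis (real j * (- z)) * cis (real k * (\<theta> - z))
      = cis (real k * \<theta>) * cis ((real i - real j - real k) * z)"
    by (simp only: cis_mult) (simp add: algebra_simps)
  have "monomial w i j k (cylindric r \<theta> z)
      = of_real (cos r ^ (i + j) * sin r ^ k) *
        (w * (cis (real i * z) * cis (real j * (- z)) * cis (real k * (\<theta> - z))))"
    by (simp only: monomial_def ca_cylindric cb_cylindric complex_cnj_mult complex_cnj_complex_of_real cis_cnj
        power_mult_distrib Complex.DeMoivre of_real_power of_real_mult power_add) (simp only: mult_ac)
  also have "\<dots> = of_real (cos r ^ (i + j) * sin r ^ k) *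
        (cis (real k * \<theta>) * (w * cis ((real i - real j - real k) * z)))"
    unfolding c by (simp only: mult_ac)
  finally show ?thesis unfolding apply_re_monomial by (simp del: of_real_mult of_real_power)
qed

text \<open>The integral over \<open>\<theta>\<close> of \<open>cis (k \<theta>)\<close> over a full period is 0.\<close>

lemma haar_harmonic_re_monomial:
  assumes "k > 0"
  shows "(LINT g|su2_haar. apply_bcontfun (harmonic v n l) g * apply_bcontfun (re_monomial w i j k) g) = 0"
proof -
  let ?\<phi> = "real i - real j - real k"
  have "(LINT g|su2_haar. apply_bcontfun (harmonic v n l) g * apply_bcontfun (re_monomial w i j k) g)
    = (1 / (4 * pi\<^sup>2)) * (integral {0..pi/2} (\<lambda>r. sin (2 * r) *
          (cos r ^ n * poly (jacobi_poly n l) ((cos r)\<^sup>2) * (cos r ^ (i + j) * sin r ^ k))) *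
     (integral {0..2*pi} (\<lambda>\<theta>. cos (real k * \<theta>))
       * integral {-pi..pi} (\<lambda>z. Re (v * cis (real n * z)) * Re (w * cis (?\<phi> * z)))
      + integral {0..2*pi} (\<lambda>\<theta>. - sin (real k * \<theta>))
       * integral {-pi..pi} (\<lambda>z. Re (v * cis (real n * z)) * Im (w * cis (?\<phi> * z)))))"
    by (rule haar_integral_product)
       (auto simp: harmonic_cylindric re_monomial_cylindric algebra_simps  intro!: continuous_intros)
  also have "integral {0..2*pi} (\<lambda>\<theta>. cos (real k * \<theta>)) = 0"
  proof -
    have "sin (real k * (2 * pi)) = 0" using sin_npi[of "2 * k"] by (simp add: mult_ac)
    then show ?thesis using assms by (simp add: integral_cos_mult)
  qed
  also have "integral {0..2*pi} (\<lambda>\<theta>. - sin (real k * \<theta>)) = 0"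
  proof -
    have "cos (real k * (2 * pi)) = 1" using cos_npi[of "2 * k"] by (simp add: mult_ac)
    then show ?thesis using assms by (simp add: integral_sin_mult)
  qed
  finally show ?thesis by simp
qed

text \<open>For \<open>m > 0\<close> the mean of \<open>cos\<^sup>2 (m z)\<close> contributes the factor 1/2; it is made up for by the two indices
\<open>n = m\<close> and \<open>n = - m\<close> of the series.\<close>

lemma haar_harmonic_harmonic:
  "(LINT g|su2_haar. apply_bcontfun (harmonic 1 n l) g * apply_bcontfun (harmonic w m k) g)
    = (if n = m \<and> l = k then (if m = 0 then 1 else 1 / 2) * Re w / (2 * real k + real m + 1) else 0)"
proof -
  have "(LINT g|su2_haar. apply_bcontfun (harmonic 1 n l) g * apply_bcontfun (harmonic w m k) g)
    = (1 / (4 * pi\<^sup>2)) * (integral {0..pi/2} (\<lambda>r. sin (2 * r) *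
          (cos r ^ n * poly (jacobi_poly n l) ((cos r)\<^sup>2) * (cos r ^ m * poly (jacobi_poly m k) ((cos r)\<^sup>2)))) *
     (integral {0..2*pi} (\<lambda>\<theta>. 1) * integral {-pi..pi} (\<lambda>z. cos (real n * z) * Re (w * cis (real m * z)))
      + integral {0..2*pi} (\<lambda>\<theta>. 0) * integral {-pi..pi} (\<lambda>z. 0)))"
    by (rule haar_integral_product)
       (auto simp: harmonic_cylindric algebra_simps  intro!: continuous_intros)
  also have "\<dots> = (1 / (2 * pi)) * integral {0..pi/2} (\<lambda>r. sin (2 * r) *
          (cos r ^ n * poly (jacobi_poly n l) ((cos r)\<^sup>2) * (cos r ^ m * poly (jacobi_poly m k) ((cos r)\<^sup>2)))) *
          (if n = m then (if m = 0 then 2 * pi else pi) * Re w else 0)"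
    unfolding integral_cos_cis by (simp add: power2_eq_square)
  also have "\<dots> = (if n = m \<and> l = k then (if m = 0 then 1 else 1 / 2) * Re w / (2 * real k + real m + 1) else 0)"
  proof (cases "n = m")
    case True
    have "(\<lambda>r. sin (2 * r) * (cos r ^ m * poly (jacobi_poly m l) ((cos r)\<^sup>2) * (cos r ^ m * poly (jacobi_poly m k) ((cos r)\<^sup>2))))
       = (\<lambda>r. sin (2 * r) * poly (monom 1 m * jacobi_poly m k * jacobi_poly m l) ((cos r)\<^sup>2))"
      by (auto simp: fun_eq_iff poly_monom power2_eq_square power_mult_distrib)
    then show ?thesis
      unfolding True using integral_poly_cos_squared[of "monom 1 m * jacobi_poly m k * jacobi_poly m l"]
      by (simp only: jacobi_orthogonal) auto
  qed simp
  finally show ?thesis .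
qed

section \<open>The eigenfunction series\<close>

definition heat_weight :: "nat \<Rightarrow> nat \<Rightarrow> real \<Rightarrow> real" where
  "heat_weight m k t = (2 * real k + real m + 1) * exp (- heat_eigenvalue m k * t)"

text \<open>The indices \<open>n\<close> and \<open>- n\<close> give the same real function: the real part of \<open>cis (n z)\<close> is even in \<open>n\<close>, and the
imaginary parts cancel in the sum.\<close>

definition heat_summand :: "real \<Rightarrow> int \<times> nat \<Rightarrow> su2 \<Rightarrow>\<^sub>C real" where
  "heat_summand t = (\<lambda>(n, k). heat_weight (nat \<bar>n\<bar>) k t *\<^sub>R harmonic 1 (nat \<bar>n\<bar>) k)"

lemma cmod_ca_le_1: "cmod (ca g) \<le> 1"
proof -
  have "complex_of_real ((cmod (ca g))\<^sup>2 + (cmod (cb g))\<^sup>2) = 1"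
    using ca_cb_norm[of g] by (simp only: complex_norm_square of_real_add)
  then have "(cmod (ca g))\<^sup>2 + (cmod (cb g))\<^sup>2 = 1" using of_real_eq_1_iff by blast
  then have "(cmod (ca g))\<^sup>2 \<le> 1" using zero_le_power2[of "cmod (cb g)"] by linarith
  then show ?thesis by (simp add: power_le_one_iff abs_square_le_1)
qed

lemma norm_harmonic_le: "norm (harmonic 1 m k) \<le> 2 ^ k * real ((m + 2 * k) choose k)"
proof (rule norm_bound)
  fix g
  have "\<bar>Re (1 * ca g ^ m)\<bar> \<le> cmod (ca g ^ m)" using abs_Re_le_cmod by simp
  also have "\<dots> \<le> 1" using cmod_ca_le_1 by (simp add: norm_power power_le_one)
  finally have "\<bar>Re (1 * ca g ^ m)\<bar> \<le> 1" .
  moreover have "\<bar>poly (jacobi_poly m k) ((cmod (ca g))\<^sup>2)\<bar> \<le> 2 ^ k * real ((m + 2 * k) choose k)"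
    by (rule jacobi_poly_bound) (use cmod_ca_le_1[of g] in \<open>auto intro: power_le_one\<close>)
  ultimately have "\<bar>Re (1 * ca g ^ m)\<bar> * \<bar>poly (jacobi_poly m k) ((cmod (ca g))\<^sup>2)\<bar>
      \<le> 1 * (2 ^ k * real ((m + 2 * k) choose k))"
    by (intro mult_mono) auto
  then show "norm (apply_bcontfun (harmonic 1 m k) g) \<le> 2 ^ k * real ((m + 2 * k) choose k)"
    by (simp only: apply_harmonic real_norm_def abs_mult mult_1_left)
qed

definition majorant_k :: "real \<Rightarrow> nat \<Rightarrow> real" where
  "majorant_k t k = (2 * real k + 1) * (2 / t) ^ k * exp (- (2 * t * (real k * real k)))"

definition majorant_m :: "real \<Rightarrow> nat \<Rightarrow> real" where
  "majorant_m t m = (real m + 1) * exp (- (2 * t * real m))"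

text \<open>With \<open>x = m + k\<close>, the coefficient bound is at most \<open>(4x)^k\<close>, and \<open>4x \<le> (2/t) exp (2tx)\<close>. Half of the
exponential \<open>exp (- 4kxt)\<close> absorbs the factor \<open>exp (2kxt)\<close> so produced; what is left is at most
\<open>exp (- 2tk\<^sup>2)\<close>, which separates the two summation indices.\<close>

lemma heat_weight_bound:
  assumes t: "t > 0"
  shows "heat_weight m k t * (2 ^ k * real ((m + 2 * k) choose k)) \<le> majorant_m t m * majorant_k t k"
proof -
  define x where "x = real (m + k)"
  have x: "real k \<le> x" by (simp add: x_def)
  have "(m + 2 * k) choose k \<le> (m + 2 * k) ^ k" by (rule binomial_le_pow) simp
  then have "real ((m + 2 * k) choose k) \<le> real (m + 2 * k) ^ k"
    by (simp only: of_nat_le_iff of_nat_power[symmetric])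
  then have "2 ^ k * real ((m + 2 * k) choose k) \<le> 2 ^ k * real (m + 2 * k) ^ k"
    by (intro mult_left_mono) auto
  also have "\<dots> = (2 * real (m + 2 * k)) ^ k" by (simp only: power_mult_distrib)
  also have "\<dots> \<le> (2 / t * exp (2 * t * x)) ^ k"
  proof (rule power_mono)
    have "2 * t * x \<le> exp (2 * t * x)" using exp_ge_add_one_self[of "2 * t * x"] by linarith
    then have "2 / t * (2 * t * x) \<le> 2 / t * exp (2 * t * x)" using t by (intro mult_left_mono) auto
    then have "4 * x \<le> 2 / t * exp (2 * t * x)" using t by simp
    then show "2 * real (m + 2 * k) \<le> 2 / t * exp (2 * t * x)" by (simp add: x_def)
  qed simp
  also have "\<dots> = (2 / t) ^ k * exp (2 * t * x * real k)"
    by (simp only: power_mult_distrib exp_of_nat2_mult)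
  finally have 1: "2 ^ k * real ((m + 2 * k) choose k) \<le> (2 / t) ^ k * exp (2 * t * x * real k)" .
  have "heat_weight m k t * (2 ^ k * real ((m + 2 * k) choose k))
      \<le> ((2 * real k + 1) * (real m + 1) * exp (- heat_eigenvalue m k * t)) * ((2 / t) ^ k * exp (2 * t * x * real k))"
    using t unfolding heat_weight_def
    by (intro mult_mono 1) (auto simp: algebra_simps)
  also have "\<dots> = ((2 * real k + 1) * (2 / t) ^ k * (real m + 1)) * exp (- heat_eigenvalue m k * t + 2 * t * x * real k)"
    by (simp only: exp_add mult_ac)
  also have "\<dots> \<le> ((2 * real k + 1) * (2 / t) ^ k * (real m + 1)) * exp (- (2 * t * (real k * real k)) + - (2 * t * real m))"
  proof (intro mult_left_mono)
    have "t * (real k * real k) \<le> t * (real k * x)" using x t by (intro mult_left_mono) auto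
    moreover have "- heat_eigenvalue m k * t + 2 * t * x * real k
        = - (2 * (t * (real k * x))) - 4 * (t * real k) - 2 * t * real m"
      by (simp add: heat_eigenvalue_def x_def algebra_simps)
    moreover have "0 \<le> t * real k" using t by simp
    ultimately have "- heat_eigenvalue m k * t + 2 * t * x * real k \<le> - (2 * (t * (real k * real k))) - 2 * t * real m"
      by linarith
    then show "exp (- heat_eigenvalue m k * t + 2 * t * x * real k) \<le> exp (- (2 * t * (real k * real k)) + - (2 * t * real m))"
      by (simp add: mult.assoc)
  qed (use t in auto)
  also have "\<dots> = majorant_m t m * majorant_k t k"
    by (simp only: exp_add majorant_m_def majorant_k_def mult_ac)
  finally show ?thesis .
qed

lemma summable_majorant_k:
  assumes t: "t > 0" shows "summable (majorant_k t)"
proof -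
  have "(\<lambda>k. exp (- (2 * t)) ^ k) \<longlonglongrightarrow> 0"
    using t by (intro LIMSEQ_realpow_zero) auto
  then have "(\<lambda>k. (3 * (2 / t)) * exp (- (2 * t)) ^ k) \<longlonglongrightarrow> 0"
    by (rule tendsto_mult_right_zero)
  then have "eventually (\<lambda>k. (3 * (2 / t)) * exp (- (2 * t)) ^ k < 1 / 2) sequentially"
    by (rule order_tendstoD) simp
  then obtain N where N: "\<And>k. k \<ge> N \<Longrightarrow> (3 * (2 / t)) * exp (- (2 * t)) ^ k < 1 / 2"
    by (auto simp: eventually_sequentially)
  show ?thesis
  proof (rule summable_ratio_test[of "1 / 2" N])
    fix k assume k: "N \<le> k"
    have e: "exp (- (2 * t * (real (Suc k) * real (Suc k))))
        \<le> exp (- (2 * t)) ^ k * exp (- (2 * t * (real k * real k)))"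
    proof -
      have "exp (- (2 * t)) ^ k * exp (- (2 * t * (real k * real k))) = exp (real k * (- (2 * t)) + - (2 * t * (real k * real k)))"
        by (simp only: exp_add exp_of_nat_mult)
      moreover have "- (2 * t * (real (Suc k) * real (Suc k))) \<le> real k * (- (2 * t)) + - (2 * t * (real k * real k))"
      proof -
        have "0 \<le> t * real k" using t by simp
        then have "0 \<le> 2 * (t * real k) + 2 * t" using t by simp
        then show ?thesis by (simp add: algebra_simps)
      qed
      ultimately show ?thesis by simp
    qed
    have "majorant_k t (Suc k) \<le> (3 * (2 * real k + 1)) * (2 / t * (2 / t) ^ k) * (exp (- (2 * t)) ^ k * exp (- (2 * t * (real k * real k))))"
      unfolding majorant_k_def power_Suc using t by (intro mult_mono e) auto
    also have "\<dots> = (3 * (2 / t)) * exp (- (2 * t)) ^ k * majorant_k t k"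
      by (simp only: majorant_k_def mult_ac)
    also have "\<dots> \<le> 1 / 2 * majorant_k t k"
      using N[OF k] t by (intro mult_right_mono) (auto simp: majorant_k_def)
    finally show "norm (majorant_k t (Suc k)) \<le> 1 / 2 * norm (majorant_k t k)"
      using t by (simp add: majorant_k_def abs_mult)
  qed simp
qed

lemma summable_majorant_m:
  assumes t: "t > 0" shows "summable (majorant_m t)"
proof -
  \<comment> \<open>from \<open>m t \<ge> 1\<close> on, the growth \<open>(m + 2)/(m + 1) \<le> 1 + t \<le> exp t\<close> uses up only half of the decay \<open>exp (- 2t)\<close>\<close>
  obtain N :: nat where N: "1 / t < real N" using reals_Archimedean2 by blast
  show ?thesis
  proof (rule summable_ratio_test[of "exp (- t)" N])
    fix m assume m: "N \<le> m"
    have "1 \<le> real m * t"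
    proof -
      have "1 < real N * t" using N t by (simp add: divide_less_eq)
      also have "\<dots> \<le> real m * t" using m t by (intro mult_right_mono) auto
      finally show ?thesis by simp
    qed
    then have "real (Suc m) + 1 \<le> (real m + 1) * (1 + t)" using t by (simp add: algebra_simps)
    also have "\<dots> \<le> (real m + 1) * exp t" by (intro mult_left_mono) auto
    finally have "majorant_m t (Suc m) \<le> (real m + 1) * exp t * exp (- (2 * t * real (Suc m)))"
      unfolding majorant_m_def by (intro mult_right_mono) auto
    also have "\<dots> = (real m + 1) * exp (t + - (2 * t * real (Suc m)))" by (simp only: exp_add mult_ac)
    also have "t + - (2 * t * real (Suc m)) = - t + - (2 * t * real m)" by (simp add: algebra_simps)
    also have "(real m + 1) * exp (- t + - (2 * t * real m)) = exp (- t) * majorant_m t m"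
      by (simp only: exp_add majorant_m_def mult_ac)
    finally show "norm (majorant_m t (Suc m)) \<le> exp (- t) * norm (majorant_m t m)"
      by (simp add: majorant_m_def abs_mult)
  qed (use t in simp)
qed

lemma summable_on_int_abs:
  fixes f :: "nat \<Rightarrow> real"
  assumes f: "summable f" "\<And>n. f n \<ge> 0"
  shows "(\<lambda>n::int. f (nat \<bar>n\<bar>)) summable_on UNIV"
proof -
  have s: "f summable_on UNIV" "(\<lambda>n. f (Suc n)) summable_on UNIV"
    using f by (auto intro!: summable_nonneg_imp_summable_on summable_Suc_iff[THEN iffD2])
  have 1: "(\<lambda>n::int. f (nat \<bar>n\<bar>)) summable_on range int"
    by (subst summable_on_reindex) (use s(1) in \<open>auto simp: o_def\<close>)
  have 2: "(\<lambda>n::int. f (nat \<bar>n\<bar>)) summable_on range (\<lambda>n. - int (Suc n))"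
    by (subst summable_on_reindex) (use s(2) in \<open>auto simp: o_def inj_def nat_add_distrib\<close>)
  have "range int \<inter> range (\<lambda>n. - int (Suc n)) = {}" by auto
  with 1 2 have "(\<lambda>n::int. f (nat \<bar>n\<bar>)) summable_on (range int \<union> range (\<lambda>n. - int (Suc n)))"
    by (rule summable_on_Un_disjoint)
  moreover have "range int \<union> range (\<lambda>n. - int (Suc n)) = UNIV"
  proof -
    have "n \<in> range int \<union> range (\<lambda>n. - int (Suc n))" for n
      by (cases n rule: int_cases) auto
    then show ?thesis by blast
  qed
  ultimately show ?thesis by simp
qed

lemma summable_majorant:
  assumes t: "t > 0"
  shows "(\<lambda>(n::int, k). majorant_m t (nat \<bar>n\<bar>) * majorant_k t k) summable_on UNIV"
proof -
  have nn: "majorant_m t m \<ge> 0" "majorant_k t k \<ge> 0" for m k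
    using t by (auto simp: majorant_m_def majorant_k_def)
  have "(\<lambda>(n::int, k). majorant_m t (nat \<bar>n\<bar>) * majorant_k t k) summable_on (UNIV \<times> UNIV)"
  proof (rule summable_on_SigmaI)
    fix n :: int
    have "(majorant_k t has_sum infsum (majorant_k t) UNIV) UNIV"
      using summable_nonneg_imp_summable_on[OF summable_majorant_k[OF t]] nn by (intro has_sum_infsum) auto
    from has_sum_cmult_right[OF this, of "majorant_m t (nat \<bar>n\<bar>)"]
    show "((\<lambda>k. (case (n, k) of (n, k) \<Rightarrow> majorant_m t (nat \<bar>n\<bar>) * majorant_k t k))
        has_sum (majorant_m t (nat \<bar>n\<bar>) * infsum (majorant_k t) UNIV)) UNIV" by simp
  next
    show "(\<lambda>n::int. majorant_m t (nat \<bar>n\<bar>) * infsum (majorant_k t) UNIV) summable_on UNIV"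
      by (intro summable_on_cmult_left summable_on_int_abs summable_majorant_m t nn)
  qed (use nn in auto)
  then show ?thesis by simp
qed

lemma heat_summand_abs_summable:
  assumes t: "t > 0"
  shows "(\<lambda>x. norm (heat_summand t x)) summable_on UNIV"
  using summable_majorant[OF t]
proof (rule summable_on_comparison_test)
  fix x :: "int \<times> nat"
  obtain n k where x: "x = (n, k)" by (cases x)
  have "norm (heat_summand t x) = heat_weight (nat \<bar>n\<bar>) k t * norm (harmonic 1 (nat \<bar>n\<bar>) k)"
    by (simp add: x heat_summand_def heat_weight_def abs_mult)
  also have "\<dots> \<le> heat_weight (nat \<bar>n\<bar>) k t * (2 ^ k * real ((nat \<bar>n\<bar> + 2 * k) choose k))"
    by (intro mult_left_mono norm_harmonic_le) (simp add: heat_weight_def)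
  also have "\<dots> \<le> majorant_m t (nat \<bar>n\<bar>) * majorant_k t k" by (rule heat_weight_bound[OF t])
  finally show "norm (heat_summand t x) \<le> (case x of (n::int, k) \<Rightarrow> majorant_m t (nat \<bar>n\<bar>) * majorant_k t k)"
    by (simp add: x)
qed simp

definition heat_series :: "real \<Rightarrow> su2 \<Rightarrow>\<^sub>C real" where
  "heat_series t = infsum (heat_summand t) UNIV"

lemma heat_series_has_sum:
  assumes "t > 0" shows "(heat_summand t has_sum heat_series t) UNIV"
  unfolding heat_series_def
  by (rule has_sum_infsum[OF abs_summable_summable[OF heat_summand_abs_summable[OF assms]]])

lemma bounded_linear_haar_pairing:
  fixes h :: "su2 \<Rightarrow>\<^sub>C real"
  shows "bounded_linear (\<lambda>f. LINT g|su2_haar. apply_bcontfun h g * apply_bcontfun f g)"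
proof -
  define C where "C = (\<lambda>(r, \<theta>, z). cylindric r \<theta> z)"
  define F where "F f x = sin (2 * fst x) * (apply_bcontfun h (C x) * apply_bcontfun f (C x))"
    for f :: "su2 \<Rightarrow>\<^sub>C real" and x :: "real \<times> real \<times> real"
  have c: "continuous_on A (\<lambda>x. apply_bcontfun f (C x))" for f :: "su2 \<Rightarrow>\<^sub>C real" and A
    unfolding C_def by (rule continuous_on_compose2[OF continuous_on_apply_bcontfun continuous_on_cylindric]) auto
  have F: "continuous_on cyl_box (F f)" for f
    unfolding F_def by (intro continuous_intros c)
  have eq: "(LINT g|su2_haar. apply_bcontfun h g * apply_bcontfun f g)
      = (1 / (4 * pi\<^sup>2)) * integral cyl_box (F f)" for f
  proof -
    have "F f = (\<lambda>(r, \<theta>, z). sin (2 * r) * (apply_bcontfun h (cylindric r \<theta> z) * apply_bcontfun f (cylindric r \<theta> z)))"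
      by (auto simp: F_def C_def)
    then show ?thesis
      using haar_integral[of "\<lambda>g. apply_bcontfun h g * apply_bcontfun f g"]
      by (simp only: continuous_on_mult continuous_on_apply_bcontfun)
  qed
  note I = integrable_continuous[OF F]
  show ?thesis
    unfolding eq
  proof (rule bounded_linear_intro)
    fix f1 f2 :: "su2 \<Rightarrow>\<^sub>C real"
    have "F (f1 + f2) = (\<lambda>x. F f1 x + F f2 x)" by (simp add: F_def fun_eq_iff distrib_left)
    then show "1 / (4 * pi\<^sup>2) * integral cyl_box (F (f1 + f2))
        = 1 / (4 * pi\<^sup>2) * integral cyl_box (F f1) + 1 / (4 * pi\<^sup>2) * integral cyl_box (F f2)"
      by (simp only: integral_add[OF I I] distrib_left)
  next
    fix a and f :: "su2 \<Rightarrow>\<^sub>C real"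
    have "F (a *\<^sub>R f) = (\<lambda>x. a * F f x)" by (simp add: F_def fun_eq_iff)
    then show "1 / (4 * pi\<^sup>2) * integral cyl_box (F (a *\<^sub>R f)) = a *\<^sub>R (1 / (4 * pi\<^sup>2) * integral cyl_box (F f))"
      by (simp only: integral_mult_right real_scaleR_def mult.left_commute)
  next
    fix f :: "su2 \<Rightarrow>\<^sub>C real"
    have bound: "norm (F f x) \<le> norm h * norm f" for x
    proof -
      have "norm (F f x) = \<bar>sin (2 * fst x)\<bar> * (norm (apply_bcontfun h (C x)) * norm (apply_bcontfun f (C x)))"
        by (simp add: F_def abs_mult)
      also have "\<dots> \<le> 1 * (norm h * norm f)"
        by (intro mult_mono norm_bounded abs_sin_le_one mult_nonneg_nonneg norm_ge_zero) simp
      finally show ?thesis by simp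
    qed
    have "norm (integral cyl_box (F f)) \<le> (norm h * norm f) * measure lborel cyl_box"
      by (rule has_integral_bound[OF _ integrable_integral[OF I] bound]) simp
    then have "1 / (4 * pi\<^sup>2) * norm (integral cyl_box (F f)) \<le> 1 / (4 * pi\<^sup>2) * ((norm h * norm f) * measure lborel cyl_box)"
      by (rule mult_left_mono) simp
    then show "norm (1 / (4 * pi\<^sup>2) * integral cyl_box (F f)) \<le> norm f * (1 / (4 * pi\<^sup>2) * norm h * measure lborel cyl_box)"
      by (simp add: abs_mult mult_ac)
  qed
qed

text \<open>Pairing with a fixed function is a bounded functional, so it commutes with the sum, which converges
in the uniform norm.\<close>

lemma heat_series_pairing:
  assumes t: "t > 0"
  shows "((\<lambda>(n, l). heat_weight (nat \<bar>n\<bar>) l t * (LINT g|su2_haar. apply_bcontfun (harmonic 1 (nat \<bar>n\<bar>) l) g * apply_bcontfun f g))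
     has_sum (LINT g|su2_haar. apply_bcontfun (heat_series t) g * apply_bcontfun f g)) UNIV"
proof -
  have b: "bounded_linear (\<lambda>h. LINT g|su2_haar. apply_bcontfun h g * apply_bcontfun f g)"
    using bounded_linear_haar_pairing[of f] by (simp add: mult.commute)
  from has_sum_bounded_linear[OF b heat_series_has_sum[OF t]]
  show ?thesis by (simp add: heat_summand_def case_prod_unfold mult.assoc)
qed

lemma heat_series_pairing_re_monomial:
  assumes t: "t > 0" and k: "k > 0"
  shows "(LINT g|su2_haar. apply_bcontfun (heat_series t) g * apply_bcontfun (re_monomial w i j k) g) = 0"
proof (rule has_sum_unique)
  show "((\<lambda>_ :: int \<times> nat. 0) has_sum (LINT g|su2_haar. apply_bcontfun (heat_series t) g * apply_bcontfun (re_monomial w i j k) g)) UNIV"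
    using heat_series_pairing[OF t, of "re_monomial w i j k"]
    unfolding haar_harmonic_re_monomial[OF k] by (simp add: case_prod_unfold)
qed simp

text \<open>By orthogonality only \<open>n = m\<close> and \<open>n = - m\<close> contribute; these coincide for \<open>m = 0\<close>.\<close>

lemma heat_series_pairing_harmonic:
  assumes t: "t > 0"
  shows "(LINT g|su2_haar. apply_bcontfun (heat_series t) g * apply_bcontfun (harmonic w m k) g)
    = exp (- heat_eigenvalue m k * t) * Re w"
proof -
  let ?f = "\<lambda>(n, l). heat_weight (nat \<bar>n\<bar>) l t
      * (LINT g|su2_haar. apply_bcontfun (harmonic 1 (nat \<bar>n\<bar>) l) g * apply_bcontfun (harmonic w m k) g)"
  have "(?f has_sum (exp (- heat_eigenvalue m k * t) * Re w)) UNIV"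
  proof (rule has_sum_finite_neutralI)
    show "finite {(int m, k), (- int m, k)}" by simp
    show "?f x = 0" if "x \<in> UNIV - {(int m, k), (- int m, k)}" for x
      using that by (cases x) (auto simp: haar_harmonic_harmonic)
    have fv: "?f (n, k) = exp (- heat_eigenvalue m k * t) * ((if m = 0 then 1 else 1 / 2) * Re w)" if "\<bar>n\<bar> = int m" for n
    proof -
      define X where "X = 2 * real k + real m + 1"
      have X: "X \<noteq> 0" by (simp add: X_def)
      have n: "nat \<bar>n\<bar> = m" using that by simp
      have "?f (n, k) = X * exp (- heat_eigenvalue m k * t) * ((if m = 0 then 1 else 1 / 2) * Re w / X)"
        by (simp only: prod.case n haar_harmonic_harmonic heat_weight_def X_def simp_thms if_True)
      then show ?thesis using X by (simp only: times_divide_eq_right) simp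
    qed
    show "exp (- heat_eigenvalue m k * t) * Re w = sum ?f {(int m, k), (- int m, k)}"
    proof (cases "m = 0")
      case True
      then have "sum ?f {(int m, k), (- int m, k)} = ?f (int m, k)" by simp
      then show ?thesis using fv[of "int m"] True by simp
    next
      case False
      then have "sum ?f {(int m, k), (- int m, k)} = ?f (int m, k) + ?f (- int m, k)" by simp
      then show ?thesis
        using fv[of "int m"] fv[of "- int m"] False by simp
    qed
  qed simp
  with heat_series_pairing[OF t, of "harmonic w m k"] show ?thesis by (rule has_sum_unique)
qed

section \<open>Density of polynomials and identification of the kernel\<close>

text \<open>The real polynomial functions on SU(2) in the form suited to the functionals below: sums of real
parts of monomials. Scalars are absorbed in the coefficient \<open>w\<close>.\<close>

inductive matrix_poly :: "(su2 \<Rightarrow> real) \<Rightarrow> bool" where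
  base: "matrix_poly (\<lambda>g. Re (monomial4 w i j k l g))"
| add: "matrix_poly f \<Longrightarrow> matrix_poly h \<Longrightarrow> matrix_poly (\<lambda>g. f g + h g)"

text \<open>This rests on \<open>Re x Re y = Re (x y) / 2 + Re (x cnj(y)) / 2\<close>.\<close>

lemma matrix_poly_mult:
  assumes "matrix_poly f" "matrix_poly h" shows "matrix_poly (\<lambda>g. f g * h g)"
  using assms
proof (induction arbitrary: h)
  case (base w i j k l)
  from base show ?case
  proof induction
    case (base w' i' j' k' l')
    have "Re x * Re y = Re (1 / 2 * (x * y)) + Re (1 / 2 * (x * cnj y))" for x y
      by (simp add: add_divide_distrib diff_divide_distrib)
    moreover have "1 / 2 * (monomial4 w i j k l g * monomial4 w' i' j' k' l' g)
        = monomial4 (1 / 2 * (w * w')) (i + i') (j + j') (k + k') (l + l') g"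
      "1 / 2 * (monomial4 w i j k l g * cnj (monomial4 w' i' j' k' l' g))
        = monomial4 (1 / 2 * (w * cnj w')) (i + j') (j + i') (k + l') (l + k') g" for g
      by (simp_all add: monomial4_def power_add mult_ac)
    ultimately have "(\<lambda>g. Re (monomial4 w i j k l g) * Re (monomial4 w' i' j' k' l' g)) =
      (\<lambda>g. Re (monomial4 (1 / 2 * (w * w')) (i + i') (j + j') (k + k') (l + l') g)
        + Re (monomial4 (1 / 2 * (w * cnj w')) (i + j') (j + i') (k + l') (l + k') g))"
      by (simp only:)
    then show ?case by (simp add: matrix_poly.intros)
  next
    case (add f h)
    then show ?case by (simp add: distrib_left matrix_poly.add)
  qed
next
  case (add f1 f2)
  then show ?case by (simp add: distrib_right matrix_poly.add)
qed

lemma matrix_poly_entry: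
  "matrix_poly (\<lambda>g. c * Re (Rep_su2 g $ i $ j))" "matrix_poly (\<lambda>g. c * Im (Rep_su2 g $ i $ j))"
proof -
  have R: "Rep_su2 g $ 2 $ 1 = - cnj (cb g)" "Rep_su2 g $ 2 $ 2 = cnj (ca g)"
      "Rep_su2 g $ 1 $ 1 = ca g" "Rep_su2 g $ 1 $ 2 = cb g" for g
    using Rep_su2[of g] by (auto simp: SU2_iff ca_def cb_def)
  have "(\<lambda>g. c * Re (Rep_su2 g $ 1 $ 1)) = (\<lambda>g. Re (monomial4 c 1 0 0 0 g))"
     "(\<lambda>g. c * Re (Rep_su2 g $ 1 $ 2)) = (\<lambda>g. Re (monomial4 c 0 0 1 0 g))"
     "(\<lambda>g. c * Re (Rep_su2 g $ 2 $ 1)) = (\<lambda>g. Re (monomial4 (- c) 0 0 0 1 g))"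
     "(\<lambda>g. c * Re (Rep_su2 g $ 2 $ 2)) = (\<lambda>g. Re (monomial4 c 0 1 0 0 g))"
     "(\<lambda>g. c * Im (Rep_su2 g $ 1 $ 1)) = (\<lambda>g. Re (monomial4 (- \<i> * c) 1 0 0 0 g))"
     "(\<lambda>g. c * Im (Rep_su2 g $ 1 $ 2)) = (\<lambda>g. Re (monomial4 (- \<i> * c) 0 0 1 0 g))"
     "(\<lambda>g. c * Im (Rep_su2 g $ 2 $ 1)) = (\<lambda>g. Re (monomial4 (\<i> * c) 0 0 0 1 g))"
     "(\<lambda>g. c * Im (Rep_su2 g $ 2 $ 2)) = (\<lambda>g. Re (monomial4 (- \<i> * c) 0 1 0 0 g))"
    by (simp_all add: R monomial4_def)
  then show "matrix_poly (\<lambda>g. c * Re (Rep_su2 g $ i $ j))" "matrix_poly (\<lambda>g. c * Im (Rep_su2 g $ i $ j))"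
    using exhaust_2[of i] exhaust_2[of j] by (auto simp only: intro: matrix_poly.base)
qed

lemma matrix_poly_real_polynomial:
  assumes "real_polynomial_function p" shows "matrix_poly (\<lambda>g. p (Rep_su2 g))"
  using assms
proof induction
  case (linear f)
  then interpret f: bounded_linear f .
  let ?E = "\<lambda>i j z. axis i (axis j z) :: complex^2^2"
  have A: "A = (Re (A$1$1) *\<^sub>R ?E 1 1 1 + Im (A$1$1) *\<^sub>R ?E 1 1 \<i>) + (Re (A$1$2) *\<^sub>R ?E 1 2 1 + Im (A$1$2) *\<^sub>R ?E 1 2 \<i>)
      + (Re (A$2$1) *\<^sub>R ?E 2 1 1 + Im (A$2$1) *\<^sub>R ?E 2 1 \<i>) + (Re (A$2$2) *\<^sub>R ?E 2 2 1 + Im (A$2$2) *\<^sub>R ?E 2 2 \<i>)"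
    for A :: "complex^2^2"
    by (simp add: vec2_eq_iff axis_def complex_eq_iff)
  have "f A = (f (?E 1 1 1) * Re (A$1$1) + f (?E 1 1 \<i>) * Im (A$1$1)) + (f (?E 1 2 1) * Re (A$1$2) + f (?E 1 2 \<i>) * Im (A$1$2))
      + (f (?E 2 1 1) * Re (A$2$1) + f (?E 2 1 \<i>) * Im (A$2$1)) + (f (?E 2 2 1) * Re (A$2$2) + f (?E 2 2 \<i>) * Im (A$2$2))" for A
    by (subst A) (simp only: f.add f.scaleR real_scaleR_def mult.commute)
  then have "(\<lambda>g. f (Rep_su2 g)) = (\<lambda>g. (f (?E 1 1 1) * Re (Rep_su2 g$1$1) + f (?E 1 1 \<i>) * Im (Rep_su2 g$1$1))
      + (f (?E 1 2 1) * Re (Rep_su2 g$1$2) + f (?E 1 2 \<i>) * Im (Rep_su2 g$1$2))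
      + (f (?E 2 1 1) * Re (Rep_su2 g$2$1) + f (?E 2 1 \<i>) * Im (Rep_su2 g$2$1))
      + (f (?E 2 2 1) * Re (Rep_su2 g$2$2) + f (?E 2 2 \<i>) * Im (Rep_su2 g$2$2)))"
    by (rule ext)
  then show ?case by (simp only:) (intro matrix_poly.add matrix_poly_entry)
next
  case (const c)
  have "(\<lambda>g. c) = (\<lambda>g. Re (monomial4 (of_real c) 0 0 0 0 g))" by (simp add: monomial4_def)
  then show ?case by (simp only: matrix_poly.base)
next
  case (add f g) show ?case by (rule matrix_poly.add[OF add.IH])
next
  case (mult f g) show ?case by (rule matrix_poly_mult[OF mult.IH])
qed

lemma continuous_on_monomial4: "continuous_on S (\<lambda>g. Re (monomial4 w i j k l g))"
  unfolding monomial4_def by (intro continuous_intros continuous_on_ca continuous_on_cb)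

lemma Bcontfun_add_su2:
  fixes f h :: "su2 \<Rightarrow> real"
  assumes "continuous_on UNIV f" "continuous_on UNIV h"
  shows "Bcontfun (\<lambda>g. f g + h g) = Bcontfun f + Bcontfun h"
  by (rule bcontfun_eqI) (simp add: apply_Bcontfun_su2 assms continuous_on_add)

text \<open>Mixed powers of \<open>b\<close> and \<open>cnj(b)\<close> are lowered by \<open>b cnj(b) = 1 - a cnj(a)\<close>; pure powers of \<open>cnj(b)\<close>
are turned into powers of \<open>b\<close> by conjugation under the real part.\<close>

lemma functional_monomial4_eq_0:
  assumes \<psi>: "bounded_linear \<psi>" and 0: "\<And>w i j k. \<psi> (re_monomial w i j k) = (0 :: real)"
  shows "\<psi> (Bcontfun (\<lambda>g. Re (monomial4 w i j k l g))) = 0"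
proof (induction k arbitrary: w i j l)
  case 0
  have "(\<lambda>g. Re (monomial4 w i j 0 l g)) = (\<lambda>g. Re (monomial (cnj w) j i l g))"
  proof
    fix g
    have "monomial (cnj w) j i l g = cnj (monomial4 w i j 0 l g)"
      by (simp add: monomial_def monomial4_def mult_ac)
    then show "Re (monomial4 w i j 0 l g) = Re (monomial (cnj w) j i l g)" by simp
  qed
  then show ?case using assms(2)[of "cnj w" j i l] by (simp add: re_monomial_def)
next
  case (Suc k)
  show ?case
  proof (cases l)
    case 0
    have "(\<lambda>g. Re (monomial4 w i j (Suc k) 0 g)) = (\<lambda>g. Re (monomial w i j (Suc k) g))"
      by (simp add: monomial_def monomial4_def)
    then show ?thesis using assms(2)[of w i j "Suc k"] by (simp add: re_monomial_def 0)
  next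
    case (Suc l')
    have "monomial4 w i j (Suc k) (Suc l') g = monomial4 w i j k l' g + monomial4 (- w) (Suc i) (Suc j) k l' g" for g
    proof -
      have b: "cb g * cnj (cb g) = 1 - ca g * cnj (ca g)" using ca_cb_norm[of g] by algebra
      have "monomial4 w i j (Suc k) (Suc l') g = monomial4 w i j k l' g * (cb g * cnj (cb g))"
        by (simp add: monomial4_def mult_ac)
      also have "\<dots> = monomial4 w i j k l' g + monomial4 (- w) (Suc i) (Suc j) k l' g"
        unfolding b by (simp add: monomial4_def algebra_simps)
      finally show ?thesis .
    qed
    then have "Bcontfun (\<lambda>g. Re (monomial4 w i j (Suc k) (Suc l') g))
        = Bcontfun (\<lambda>g. Re (monomial4 w i j k l' g)) + Bcontfun (\<lambda>g. Re (monomial4 (- w) (Suc i) (Suc j) k l' g))"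
      by (simp add: Bcontfun_add_su2 continuous_on_monomial4)
    then show ?thesis using Suc.IH bounded_linear.linear[OF \<psi>] by (simp add: Suc linear_add)
  qed
qed

lemma functional_eq_0:
  assumes \<psi>: "bounded_linear \<psi>" and 0: "\<And>w i j k. \<psi> (re_monomial w i j k) = (0 :: real)"
  shows "\<psi> f = 0"
proof -
  interpret \<psi>: bounded_linear \<psi> by fact
  have mp: "continuous_on UNIV q \<and> \<psi> (Bcontfun q) = 0" if "matrix_poly q" for q
    using that
  proof induction
    case (base w i j k l)
    show ?case using continuous_on_monomial4 functional_monomial4_eq_0[OF assms] by blast
  next
    case (add f h)
    then show ?case by (simp add: Bcontfun_add_su2 \<psi>.add continuous_on_add)
  qed
  obtain K where K: "K > 0" "\<And>x. norm (\<psi> x) \<le> norm x * K"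
    using \<psi>.pos_bounded by blast
  have "\<bar>\<psi> f\<bar> \<le> e" if e: "e > 0" for e
  proof -
    have "continuous_on SU2 Abs_su2"
      unfolding continuous_on_iff by (auto simp: dist_su2_def Abs_su2_inverse)
    then have "continuous_on SU2 (\<lambda>A. apply_bcontfun f (Abs_su2 A))"
      by (rule continuous_on_compose2[OF continuous_on_apply_bcontfun]) auto
    then obtain p where p: "real_polynomial_function p" "\<And>A. A \<in> SU2 \<Longrightarrow> \<bar>apply_bcontfun f (Abs_su2 A) - p A\<bar> < e / K"
      using Stone_Weierstrass_real_polynomial_function[OF compact_SU2, of _ "e / K"] e K by (metis divide_pos_pos)
    define q where "q = (\<lambda>g. p (Rep_su2 g))"
    have q: "continuous_on UNIV q" "\<psi> (Bcontfun q) = 0"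
      using mp[OF matrix_poly_real_polynomial[OF p(1)]] by (auto simp: q_def)
    have "norm (f - Bcontfun q) \<le> e / K"
    proof (rule norm_bound)
      fix g
      show "norm (apply_bcontfun (f - Bcontfun q) g) \<le> e / K"
        using p(2)[OF Rep_su2[of g]] by (simp add: apply_Bcontfun_su2[OF q(1)] Rep_su2_inverse) (simp add: q_def)
    qed
    then have "norm (f - Bcontfun q) * K \<le> e" using K by (simp add: pos_le_divide_eq)
    then have "norm (\<psi> (f - Bcontfun q)) \<le> e" using K(2)[of "f - Bcontfun q"] by linarith
    then show ?thesis using q(2) by (simp add: \<psi>.diff)
  qed
  then show ?thesis using field_le_epsilon[of "\<bar>\<psi> f\<bar>" 0] by force
qed

lemma su2_smooth_continuous: "su2_smooth f \<Longrightarrow> continuous_on UNIV f"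
proof -
  assume "su2_smooth f"
  then obtain F where F: "\<And>k. Ck k F" "f = F \<circ> Rep_su2" by (auto simp: su2_smooth_def)
  have "continuous_on UNIV F" using F(1)[of 0] by simp
  then show ?thesis unfolding F(2) o_def
    by (rule continuous_on_compose2[OF _ continuous_on_Rep_su2]) auto
qed

text \<open>Let \<open>h\<close> be the difference of the two sides. Its pairing with every eigenfunction and with every
monomial with \<open>k > 0\<close> is 0. For \<open>k = 0\<close> the monomials \<open>\<bar>a\<bar>^(2s) a^m\<close> are recovered from the eigenfunctions by
induction on \<open>s\<close>, since the top coefficients are nonzero. Hence \<open>h\<close> is orthogonal to all continuous
functions, in particular to itself.\<close>

lemma heat_kernel_eq_series:
  assumes P: "is_heat_semigroup P" and p: "is_heat_kernel P p" and t: "t > 0"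
    and r: "0 \<le> r" "r < pi / 2" and \<theta>: "\<theta> \<in> {0..2 * pi}" and z: "z \<in> {-pi..pi}"
  shows "p t (cylindric r \<theta> z) = apply_bcontfun (heat_series t) (cylindric r \<theta> z)"
proof -
  define q where "q = Bcontfun (p t)"
  have q: "apply_bcontfun q = p t"
    unfolding q_def using p t by (intro apply_Bcontfun_su2 su2_smooth_continuous) (auto simp: is_heat_kernel_def)
  define h where "h = q - heat_series t"
  define \<psi> where "\<psi> f = (LINT g|su2_haar. apply_bcontfun h g * apply_bcontfun f g)" for f
  have \<psi>: "bounded_linear \<psi>"
    unfolding \<psi>_def by (rule bounded_linear_haar_pairing)
  interpret \<psi>: bounded_linear \<psi> by (rule \<psi>)
  have \<psi>_eq: "\<psi> f = apply_bcontfun (P t f) su2_one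
      - (LINT g|su2_haar. apply_bcontfun (heat_series t) g * apply_bcontfun f g)" for f
  proof -
    have "\<psi> f = (LINT g|su2_haar. apply_bcontfun f g * apply_bcontfun (q - heat_series t) g)"
      by (simp add: \<psi>_def h_def mult.commute)
    also have "\<dots> = (LINT g|su2_haar. apply_bcontfun f g * apply_bcontfun q g)
        - (LINT g|su2_haar. apply_bcontfun f g * apply_bcontfun (heat_series t) g)"
      by (rule linear_diff[OF bounded_linear.linear[OF bounded_linear_haar_pairing]])
    finally show ?thesis using p t by (simp add: is_heat_kernel_def q mult.commute)
  qed
  have harm: "\<psi> (harmonic w m k) = 0" for w m k
    using t by (simp add: \<psi>_eq heat_harmonic_at_one[OF P] heat_series_pairing_harmonic)
  have diag: "\<psi> (re_monomial w (m + s) s 0) = 0" for w m s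
  proof (induction s rule: less_induct)
    case (less s)
    have "0 = \<psi> (harmonic w m s)" by (simp add: harm)
    also have "\<dots> = (\<Sum>s'\<le>s. jacobi_coeff m s s' * \<psi> (re_monomial w (m + s') s' 0))"
      by (simp add: harmonic_def \<psi>.sum \<psi>.scaleR)
    also have "\<dots> = (\<Sum>s'\<in>{s}. jacobi_coeff m s s' * \<psi> (re_monomial w (m + s') s' 0))"
      by (rule sum.mono_neutral_right) (use less in auto)
    finally show ?case by (simp add: jacobi_coeff_top)
  qed
  have re: "\<psi> (re_monomial w i j k) = 0" for w i j k
  proof (cases "k = 0")
    case True
    show ?thesis
    proof (cases "j \<le> i")
      case True
      then show ?thesis using diag[of w "i - j" j] \<open>k = 0\<close> by simp
    next
      case False
      have "re_monomial w i j 0 = re_monomial (cnj w) j i 0"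
      proof (rule bcontfun_eqI)
        fix g
        have "monomial (cnj w) j i 0 g = cnj (monomial w i j 0 g)"
          by (simp add: monomial_def mult_ac)
        then show "apply_bcontfun (re_monomial w i j 0) g = apply_bcontfun (re_monomial (cnj w) j i 0) g"
          by (simp add: apply_re_monomial)
      qed
      then show ?thesis using diag[of "cnj w" "j - i" i] \<open>k = 0\<close> False by simp
    qed
  next
    case False
    then show ?thesis
      using t by (simp add: \<psi>_eq heat_re_monomial_at_one[OF P] heat_series_pairing_re_monomial)
  qed
  have "\<psi> h = 0" by (rule functional_eq_0[OF \<psi> re])
  then have "apply_bcontfun h (cylindric r \<theta> z) * apply_bcontfun h (cylindric r \<theta> z) = 0"
    unfolding \<psi>_def
    by (intro haar_faithful[of "\<lambda>g. apply_bcontfun h g * apply_bcontfun h g"] r \<theta> z continuous_on_mult) auto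
  then show ?thesis by (simp add: h_def q)
qed

text \<open>The restriction \<open>r < \<pi>/2\<close> keeps \<open>cos 2r\<close> away from \<open>-1\<close>, where the denominator in Rodrigues'
formula vanishes.\<close>

lemma heat_term_eq:
  assumes "0 \<le> r" "r < pi / 2"
  shows "heat_term t r z n k = of_real (heat_weight (nat \<bar>n\<bar>) k t * (cos r ^ nat \<bar>n\<bar> * poly (jacobi_poly (nat \<bar>n\<bar>) k) ((cos r)\<^sup>2)))
    * cis (of_int n * z)"
proof -
  have "cos r > 0" using assms by (intro cos_gt_zero_pi) auto
  then have "jacobi0 (nat \<bar>n\<bar>) k (cos (2 * r)) = poly (jacobi_poly (nat \<bar>n\<bar>) k) ((cos r)\<^sup>2)"
    using jacobi0_eq_jacobi_poly[of "(cos r)\<^sup>2" "nat \<bar>n\<bar>" k] by (simp add: cos_double_cos)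
  moreover have "exp (\<i> * of_int n * complex_of_real z) = cis (of_int n * z)"
    by (simp add: cis_conv_exp mult.assoc)
  ultimately show ?thesis
    unfolding heat_term_def Let_def heat_weight_def heat_eigenvalue_def of_real_mult
    by (simp only: mult_ac mult_minus_left)
qed

lemma heat_term_summable:
  assumes t: "t > 0" and r: "0 \<le> r" "r < pi / 2"
  shows "(\<lambda>(n, k). heat_term t r z n k) summable_on (UNIV :: (int \<times> nat) set)"
proof (rule abs_summable_summable)
  show "(\<lambda>x. norm (case x of (n, k) \<Rightarrow> heat_term t r z n k)) summable_on (UNIV :: (int \<times> nat) set)"
    using summable_majorant[OF t]
  proof (rule summable_on_comparison_test)
    fix x :: "int \<times> nat"
    obtain n k where x: "x = (n, k)" by (cases x)
    let ?m = "nat \<bar>n\<bar>"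
    have "0 \<le> cos r" using r by (intro cos_ge_zero) auto
    have "norm (heat_term t r z n k) = heat_weight ?m k t * (\<bar>cos r\<bar> ^ ?m * \<bar>poly (jacobi_poly ?m k) ((cos r)\<^sup>2)\<bar>)"
      unfolding heat_term_eq[OF r] norm_mult norm_of_real by (simp add: abs_mult power_abs heat_weight_def)
    also have "\<dots> \<le> heat_weight ?m k t * (1 * (2 ^ k * real ((?m + 2 * k) choose k)))"
      by (intro mult_left_mono mult_mono jacobi_poly_bound power_le_one)
         (use \<open>0 \<le> cos r\<close> in \<open>auto simp: heat_weight_def abs_square_le_1\<close>)
    also have "\<dots> \<le> majorant_m t ?m * majorant_k t k" using heat_weight_bound[OF t] by simp
    finally show "norm (case x of (n, k) \<Rightarrow> heat_term t r z n k) \<le> (case x of (n, k) \<Rightarrow> majorant_m t (nat \<bar>n\<bar>) * majorant_k t k)"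
      by (simp add: x)
  qed simp
qed

text \<open>The real parts of the complex terms are the values of the summands of the uniform series. The sum is
real because conjugation amounts to the change \<open>n \<mapsto> - n\<close> of index.\<close>

lemma heat_series_cylindric:
  assumes t: "t > 0" and r: "0 \<le> r" "r < pi / 2"
  shows "complex_of_real (apply_bcontfun (heat_series t) (cylindric r \<theta> z))
    = infsum (\<lambda>(n, k). heat_term t r z n k) (UNIV :: (int \<times> nat) set)"
proof -
  let ?T = "\<lambda>(n, k). heat_term t r z n k" and ?g = "cylindric r \<theta> z"
  define S where "S = infsum ?T (UNIV :: (int \<times> nat) set)"
  have S: "(?T has_sum S) UNIV"
    unfolding S_def by (rule has_sum_infsum[OF heat_term_summable[OF assms]])
  have "((\<lambda>x. Re (?T x)) has_sum Re S) UNIV"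
    by (rule has_sum_bounded_linear[OF bounded_linear_Re S])
  moreover have "((\<lambda>x. apply_bcontfun (heat_summand t x) ?g) has_sum apply_bcontfun (heat_series t) ?g) UNIV"
    by (rule has_sum_bounded_linear[OF bounded_linear_apply_bcontfun heat_series_has_sum[OF t]])
  moreover have "Re (?T x) = apply_bcontfun (heat_summand t x) ?g" for x
  proof -
    obtain n k where x: "x = (n, k)" by (cases x)
    have "cos (of_int n * z) = cos (real (nat \<bar>n\<bar>) * z)"
    proof (cases "n \<ge> 0")
      case False
      then have "real (nat \<bar>n\<bar>) * z = - (of_int n * z)" by simp
      then show ?thesis by (simp only: cos_minus)
    qed simp
    then show ?thesis
      by (simp add: x heat_term_eq[OF r] heat_summand_def harmonic_cylindric)
  qed
  ultimately have "Re S = apply_bcontfun (heat_series t) ?g"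
    using has_sum_unique by simp
  moreover have "Im S = 0"
  proof -
    let ?\<sigma> = "\<lambda>(n :: int, k :: nat). (- n, k)"
    have "((\<lambda>x. cnj (?T x)) has_sum cnj S) UNIV"
      by (rule has_sum_bounded_linear[OF bounded_linear_cnj S])
    moreover have "(\<lambda>x. cnj (?T x)) = ?T \<circ> ?\<sigma>"
      by (auto simp: fun_eq_iff heat_term_eq[OF r] cis_cnj)
    ultimately have "((?T \<circ> ?\<sigma>) has_sum cnj S) UNIV" by simp
    moreover have "inj ?\<sigma>" by (auto simp: inj_def)
    ultimately have "(?T has_sum cnj S) (range ?\<sigma>)" by (simp add: has_sum_reindex)
    moreover have "range ?\<sigma> = UNIV"
    proof -
      have "x \<in> range ?\<sigma>" for x by (rule range_eqI[of _ _ "?\<sigma> x"]) (simp add: case_prod_unfold)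
      then show ?thesis by blast
    qed
    ultimately have "cnj S = S" using S has_sum_unique by metis
    then show ?thesis by (simp add: complex_eq_iff)
  qed
  ultimately show ?thesis by (simp add: S_def[symmetric] complex_eq_iff)
qed

theorem proposition3p1:
  fixes P :: "real \<Rightarrow> (su2 \<Rightarrow>\<^sub>C real) \<Rightarrow>\<^sub>L (su2 \<Rightarrow>\<^sub>C real)"
    and p :: "real \<Rightarrow> su2 \<Rightarrow> real"
    and t r \<theta> z :: real
  assumes "is_heat_semigroup P"
    and "is_heat_kernel P p"
    and "t > 0"
    and "0 \<le> r" and "r < pi / 2"
    and "\<theta> \<in> {0..2 * pi}"
    and "z \<in> {-pi..pi}"
  shows "(\<lambda>(n, k). heat_term t r z n k) summable_on (UNIV :: (int \<times> nat) set)
    \<and> complex_of_real (p t (cylindric r \<theta> z)) = (\<Sum>\<^sub>\<infinity>n::int. \<Sum>\<^sub>\<infinity>k::nat. heat_term t r z n k)"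
proof
  show s: "(\<lambda>(n, k). heat_term t r z n k) summable_on (UNIV :: (int \<times> nat) set)"
    by (rule heat_term_summable[OF assms(3-5)])
  have "complex_of_real (p t (cylindric r \<theta> z)) = infsum (\<lambda>(n, k). heat_term t r z n k) (UNIV :: (int \<times> nat) set)"
    by (simp only: heat_kernel_eq_series[OF assms] heat_series_cylindric[OF assms(3-5)])
  also have "\<dots> = (\<Sum>\<^sub>\<infinity>n::int. \<Sum>\<^sub>\<infinity>k::nat. heat_term t r z n k)"
    using infsum_Sigma'_banach[of "heat_term t r z" UNIV "\<lambda>_. UNIV"] s by simp
  finally show "complex_of_real (p t (cylindric r \<theta> z)) = (\<Sum>\<^sub>\<infinity>n::int. \<Sum>\<^sub>\<infinity>k::nat. heat_term t r z n k)" .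
qed

end
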